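(* Let $T>0$, $\delta>0$, $\alpha>0$, let $(x_t)_{t\ge0}$ be a standard one-dimensional Brownian motion with $x_0=0$, and let $\tau_\delta=\inf\{t\ge 0:|x_t|=\delta\}$. Define $$\Upsilon(T,\alpha,\delta)=\mathbb E\left[\int_0^{\tau_\delta\wedge T}x_s^2\,ds+\alpha\left[(T-\tau_\delta)^+\right]^2\right].$$ Then, with $\lambda=\frac{T\pi^2}{8\delta^2}$, $$\Upsilon(T,\alpha,\delta)=\frac{T^2}{2}\left\{\phi(\lambda)+\left[\tfrac12-\alpha\right]\psi(\lambda)\right\},$$ where $$\phi(\lambda)=1+\frac{\pi^4}{32\lambda^2}-\frac{\pi^2}{4\lambda}-\frac{\pi}{\lambda^2}\sum_{k\ge0}\frac{(-1)^k e^{-(2k+1)^2\lambda}}{(2k+1)^3},$$ $$\psi(\lambda)=-\frac{5\pi^4}{96\lambda^2}+\frac{\pi^2}{2\lambda}-2+\frac{16}{\pi\lambda^2}\sum_{k\ge0}\frac{(-1)^k e^{-(2k+1)^2\lambda}}{(2k+1)^5}.$$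
   Context: Here $a\wedge b=\min(a,b)$ and $a^+=\max(a,0)$. *)

theory Defs
  imports "HOL-Probability.Probability"
begin

(* The process is indexed by type real; its values at negative times are irrelevant.
   All paths are required to be continuous on [0, \<infinity>), not just almost all of them, so that
   hitting times are measurable without completeness of M. *)
locale standard_brownian_motion = prob_space M
  for M :: "'a measure" and x :: "real \<Rightarrow> 'a \<Rightarrow> real" +
  assumes random_variables: "\<And>t. 0 \<le> t \<Longrightarrow> x t \<in> borel_measurable M"
    and starts_at_zero: "AE \<omega> in M. x 0 \<omega> = 0"
    and independent_increments:
      "\<And>(n :: nat) t. 0 \<le> t 0 \<Longrightarrow> (\<And>i. i < n \<Longrightarrow> t i \<le> t (Suc i)) \<Longrightarrow>
         indep_vars (\<lambda>_. borel) (\<lambda>i \<omega>. x (t (Suc i)) \<omega> - x (t i) \<omega>) {..<n}"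
    and gaussian_increments:
      "\<And>s t. 0 \<le> s \<Longrightarrow> s < t \<Longrightarrow>
         distributed M lborel (\<lambda>\<omega>. x t \<omega> - x s \<omega>) (normal_density 0 (sqrt (t - s)))"
    and continuous_paths: "\<And>\<omega>. \<omega> \<in> space M \<Longrightarrow> continuous_on {0..} (\<lambda>t. x t \<omega>)"

(* Equal to \<infinity> if the path never hits the level, as Inf {} = \<infinity> in ereal. *)
definition exit_time :: "(real \<Rightarrow> 'a \<Rightarrow> real) \<Rightarrow> real \<Rightarrow> 'a \<Rightarrow> ereal" where
  "exit_time x \<delta> \<omega> = Inf (ereal ` {t. 0 \<le> t \<and> \<bar>x t \<omega>\<bar> = \<delta>})"

definition Upsilon ::
    "'a measure \<Rightarrow> (real \<Rightarrow> 'a \<Rightarrow> real) \<Rightarrow> real \<Rightarrow> real \<Rightarrow> real \<Rightarrow> real" where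
  "Upsilon M x T \<alpha> \<delta> =
     prob_space.expectation M
       (\<lambda>\<omega>. (LBINT s = 0..min (exit_time x \<delta> \<omega>) (ereal T). (x s \<omega>)\<^sup>2)
            + \<alpha> * (real_of_ereal (max (ereal T - exit_time x \<delta> \<omega>) 0))\<^sup>2)"

definition phi :: "real \<Rightarrow> real" where
  "phi l = 1 + pi ^ 4 / (32 * l\<^sup>2) - pi\<^sup>2 / (4 * l)
     - pi / l\<^sup>2 * (\<Sum>k::nat. (- 1) ^ k * exp (- ((2 * real k + 1)\<^sup>2 * l)) / (2 * real k + 1) ^ 3)"

definition psi :: "real \<Rightarrow> real" where
  "psi l = - (5 * pi ^ 4 / (96 * l\<^sup>2)) + pi\<^sup>2 / (2 * l) - 2
     + 16 / (pi * l\<^sup>2) * (\<Sum>k::nat. (- 1) ^ k * exp (- ((2 * real k + 1)\<^sup>2 * l)) / (2 * real k + 1) ^ 5)"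

end

theory Submission
  imports Defs
begin

text \<open>
  Everything rests on the martingales \<open>exp (a\<^sup>2 t / 2) * cos (a x\<^sub>t)\<close>, stopped at the minimum \<open>\<sigma>\<close> of \<open>T\<close> and the
  exit time. Letting \<open>a \<rightarrow> 0\<close> in \<open>E (exp (a\<^sup>2 \<sigma> / 2) * cos (a x\<^sub>\<sigma>)) = 1\<close> gives \<open>E \<sigma> = E x\<^sub>\<sigma>\<^sup>2\<close>; choosing
  \<open>a = (2 k + 1) \<pi> / (2 \<delta>)\<close>, for which the cosine vanishes at the barrier, gives the cosine coefficients of
  the law of \<open>x\<^sub>T\<close> on the event of no exit before \<open>T\<close>. As \<open>\<delta>\<^sup>2 - y\<^sup>2\<close> also vanishes at the barrier, its cosine
  series converges absolutely and yields \<open>A t = E (\<delta>\<^sup>2 - x\<^sub>t\<^sup>2; no exit before t)\<close> as a series, while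
  \<open>E (min t exit) = \<delta>\<^sup>2 - A t\<close>. Integrating over \<open>t\<close>, all expectations in question reduce to \<open>A T\<close> and to
  the integral of \<open>A\<close>: on the one hand the integral of \<open>x\<^sup>2\<close> up to \<open>\<sigma>\<close> is \<open>\<delta>\<^sup>2 \<sigma>\<close> minus the integral of \<open>\<delta>\<^sup>2 - x\<^sup>2\<close>, on
  the other hand \<open>(T - \<sigma>)\<^sup>2\<close> is the integral of \<open>2 (t - min t \<sigma>)\<close> over \<open>t\<close> from \<open>0\<close> to \<open>T\<close>.
\<close>

section \<open>Two cosine series\<close>

text \<open>Term-by-term integration: the derivative series converges uniformly and the series
  itself converges at \<open>x0\<close>, so its sum has derivative \<open>g'\<close> and differs
  from \<open>G\<close> by a constant on the convex set. Each use below raises the exponent of 2k +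
  1 by one.\<close>

lemma sums_by_antiderivative:
  fixes f f' :: "nat \<Rightarrow> real \<Rightarrow> real"
  assumes "convex S"
    and "\<And>n x. x \<in> S \<Longrightarrow> (f n has_real_derivative f' n x) (at x within S)"
    and "uniform_limit S (\<lambda>n x. \<Sum>i<n. f' i x) g' sequentially"
    and "x0 \<in> S" "(\<lambda>n. f n x0) sums c"
    and G: "\<And>x. x \<in> S \<Longrightarrow> (G has_real_derivative g' x) (at x within S)"
    and "x \<in> S"
  shows "(\<lambda>n. f n x) sums (G x - G x0 + c)"
proof -
  obtain g where g: "\<And>x. x \<in> S \<Longrightarrow> (\<lambda>n. f n x) sums g x"
      "\<And>x. x \<in> S \<Longrightarrow> (g has_real_derivative g' x) (at x within S)"
    using has_field_derivative_series[OF assms(1-4)] sums_summable[OF assms(5)] by blast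
  have "\<exists>d. \<forall>x\<in>S. g x - G x = d"
    using has_field_derivative_zero_constant[OF \<open>convex S\<close>, of "\<lambda>x. g x - G x"]
      DERIV_diff[OF g(2) G] by auto
  then have "g x - G x = g x0 - G x0" using assms(4,7) by metis
  moreover have "g x0 = c" using g(1)[OF assms(4)] assms(5) sums_unique2 by blast
  ultimately have "g x = G x - G x0 + c" by linarith
  then show ?thesis using g(1)[OF assms(7)] by simp
qed

text \<open>The exponents are two variables linked by \<open>n = Suc m\<close>, so that pairs of
  numerals can be inserted directly.\<close>

lemma DERIV_sin_divide_power:
  assumes "c \<noteq> (0::real)" "n = Suc m"
  shows "((\<lambda>t. s * sin (c * t) / c ^ n) has_real_derivative s * cos (c * t) / c ^ m) (at t within S)"
  using assms by (auto intro!: derivative_eq_intros)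

lemma DERIV_cos_divide_power:
  assumes "c \<noteq> (0::real)" "n = Suc m"
  shows "((\<lambda>t. s * cos (c * t) / c ^ n) has_real_derivative s * (- sin (c * t)) / c ^ m) (at t within S)"
  using assms by (auto intro!: derivative_eq_intros)

text \<open>The product formula turns \<open>2 * sin ((2 * real N + 1) * t) * cos t\<close> into a
  sum of two neighbouring sines, and the alternating signs make these telescope. This yields the
  derivative of the cosine partial sums in closed form.\<close>

lemma sum_alternating_sin_odd:
  "(\<Sum>k<N. (-1) ^ k * sin ((2 * real k + 1) * t)) * (2 * cos t) = - ((-1) ^ N * sin (2 * real N * t))"
proof (induction N)
  case (Suc N)
  have "2 * sin ((2 * real N + 1) * t) * cos t = sin (2 * real (Suc N) * t) + sin (2 * real N * t)"
    using sin_times_cos[of "(2 * real N + 1) * t" t] by (simp add: algebra_simps)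
  then show ?case using Suc by (simp add: algebra_simps)
qed simp

lemma uniform_limit_alternating_cos_odd:
  assumes "0 < \<rho>" "\<rho> < pi / 2"
  shows "uniform_limit {-\<rho>..\<rho>}
    (\<lambda>N t. \<Sum>k<N. (-1) ^ k * cos ((2 * real k + 1) * t) / (2 * real k + 1)) (\<lambda>_. pi / 4) sequentially"
proof -
  define D where "D N t = (\<Sum>k<N. (-1) ^ k * cos ((2 * real k + 1) * t) / (2 * real k + 1))" for N t
  \<comment> \<open>Adding this multiple of \<open>cos (2 N t) / cos t\<close>, i.e. integrating by parts, makes the derivative \<open>O(1/N)\<close>.\<close>
  define Q where "Q N t = D N t + (-1) ^ N * cos (2 * real N * t) / (4 * real N * cos t)" for N t
  have c0: "cos \<rho> > 0" using assms by (intro cos_gt_zero) auto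
  have cr: "cos t \<ge> cos \<rho>" if "t \<in> {-\<rho>..\<rho>}" for t
    using that assms cos_mono_le_eq[of \<rho> "\<bar>t\<bar>"] by auto
  \<comment> \<open>This derivative oscillates faster as \<open>N\<close> grows but does not become
    small, which is why \<open>Q\<close> is estimated in place of \<open>D\<close>.\<close>
  have dD: "(D N has_real_derivative (-1) ^ N * sin (2 * real N * t) / (2 * cos t)) (at t within {-\<rho>..\<rho>})"
    if "t \<in> {-\<rho>..\<rho>}" for N t
  proof -
    have "(D N has_real_derivative - (\<Sum>k<N. (-1) ^ k * sin ((2 * real k + 1) * t))) (at t within {-\<rho>..\<rho>})"
      unfolding D_def sum_negf[symmetric]
    proof (rule DERIV_sum)
      fix k
      show "((\<lambda>t. (-1) ^ k * cos ((2 * real k + 1) * t) / (2 * real k + 1)) has_real_derivative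
          - ((-1) ^ k * sin ((2 * real k + 1) * t))) (at t within {-\<rho>..\<rho>})"
        using DERIV_cos_divide_power[of "2 * real k + 1" 1 0 "(-1) ^ k"] by simp
    qed
    moreover have "- (\<Sum>k<N. (-1) ^ k * sin ((2 * real k + 1) * t)) = (-1) ^ N * sin (2 * real N * t) / (2 * cos t)"
      using sum_alternating_sin_odd[where N=N and t=t] cr[OF that] c0 by (simp add: field_simps)
    ultimately show ?thesis by simp
  qed
  have dQ: "(Q N has_real_derivative (-1) ^ N * cos (2 * real N * t) * sin t / (4 * real N * (cos t)\<^sup>2)) (at t within {-\<rho>..\<rho>})"
    if "t \<in> {-\<rho>..\<rho>}" "N > 0" for N t
  proof -
    have "cos t > 0" using cr[OF that(1)] c0 by linarith
    then show ?thesis unfolding Q_def using \<open>N > 0\<close>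
      by (auto intro!: derivative_eq_intros dD that simp: field_simps power2_eq_square)
  qed
  have bQ: "norm (Q N t - Q N 0) \<le> 1 / (4 * real N * (cos \<rho>)\<^sup>2) * norm (t - 0)"
    if "t \<in> {-\<rho>..\<rho>}" "N > 0" for N t
  proof (rule field_differentiable_bound[OF convex_real_interval(5) dQ[OF _ that(2)]])
    fix z assume z: "z \<in> {-\<rho>..\<rho>}"
    have "\<bar>cos (2 * real N * z) * sin z\<bar> \<le> 1 * 1"
      unfolding abs_mult by (intro mult_mono) auto
    moreover have "(cos \<rho>)\<^sup>2 \<le> (cos z)\<^sup>2" using cr[OF z] c0 by (intro power_mono) auto
    ultimately show "norm ((-1) ^ N * cos (2 * real N * z) * sin z / (4 * real N * (cos z)\<^sup>2))
       \<le> 1 / (4 * real N * (cos \<rho>)\<^sup>2)"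
      using \<open>N > 0\<close> c0 by (simp add: abs_mult power_abs) (intro frac_le mult_left_mono, auto)
  qed (use that assms in auto)
  \<comment> \<open>The three terms come from the change of \<open>Q\<close> over a distance of at
    most \<rho> and from the correction terms at \<open>t\<close> and at 0.\<close>
  define C where "C = \<rho> / (4 * (cos \<rho>)\<^sup>2) + 1 / (4 * cos \<rho>) + 1 / 4"
  have bD: "\<bar>D N t - D N 0\<bar> \<le> C / real N" if t: "t \<in> {-\<rho>..\<rho>}" and N: "N > 0" for N t
  proof -
    have q: "\<bar>(-1) ^ N * cos (2 * real N * s) / (4 * real N * cos s)\<bar> \<le> 1 / (4 * real N * cos r)"
      if "cos r > 0" "cos s \<ge> cos r" for s r
      using that N by (simp add: abs_mult power_abs) (intro frac_le mult_left_mono, auto)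
    have "1 / (4 * real N * (cos \<rho>)\<^sup>2) * norm (t - 0) \<le> 1 / (4 * real N * (cos \<rho>)\<^sup>2) * \<rho>"
      using t by (intro mult_left_mono) auto
    then have "\<bar>Q N t - Q N 0\<bar> \<le> 1 / (4 * real N * (cos \<rho>)\<^sup>2) * \<rho>" using bQ[OF t N] by simp
    moreover have "D N t - D N 0 = (Q N t - Q N 0)
        - (-1) ^ N * cos (2 * real N * t) / (4 * real N * cos t)
        + (-1) ^ N * cos (2 * real N * 0) / (4 * real N * cos 0)" by (simp add: Q_def)
    ultimately have "\<bar>D N t - D N 0\<bar> \<le> 1 / (4 * real N * (cos \<rho>)\<^sup>2) * \<rho> + 1 / (4 * real N * cos \<rho>)
        + 1 / (4 * real N * cos 0)"
      using q[OF c0 cr[OF t]] q[of 0 0] unfolding abs_le_iff cos_zero mult_zero_right by linarith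
    also have "\<dots> = C / real N" by (simp add: C_def add_divide_distrib mult_ac)
    finally show ?thesis .
  qed
  have "uniform_limit {-\<rho>..\<rho>} (\<lambda>N t. D N t - D N 0) (\<lambda>_. 0) sequentially"
  proof (rule uniform_limit_sequentially_iff[THEN iffD2], safe)
    fix e :: real assume "e > 0"
    obtain N0 where N0: "real N0 > C / e" using reals_Archimedean2 by blast
    have "dist (D n t - D n 0) 0 < e" if "n \<ge> Suc N0" "t \<in> {-\<rho>..\<rho>}" for n t
    proof -
      have "C / e < real n" using N0 that(1) by linarith
      then have "C / real n < e" using \<open>e > 0\<close> that(1) by (simp add: field_simps)
      then show ?thesis using bD[OF that(2), of n] that(1) by simp
    qed
    then show "\<exists>N. \<forall>n\<ge>N. \<forall>x\<in>{-\<rho>..\<rho>}. dist (D n x - D n 0) 0 < e" by blast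
  qed
  moreover have "uniform_limit {-\<rho>..\<rho>} (\<lambda>N t. D N 0) (\<lambda>_. pi / 4) sequentially"
  proof -
    have "summable (\<lambda>k. (-1) ^ k * (1 / real (k * 2 + 1)))"
      using summable_arctan_series[of 1] by simp
    then have "(\<lambda>k. (-1) ^ k * (1 / real (k * 2 + 1))) sums (pi / 4)"
      unfolding sums_iff using pi_series by simp
    then have "(\<lambda>N. D N 0) \<longlonglongrightarrow> pi / 4"
      unfolding sums_def D_def by (simp add: algebra_simps)
    then show ?thesis by (auto simp: uniform_limit_iff tendsto_iff elim!: eventually_mono)
  qed
  ultimately have "uniform_limit {-\<rho>..\<rho>} (\<lambda>N t. (D N t - D N 0) + D N 0) (\<lambda>_. 0 + pi / 4) sequentially"
    by (rule uniform_limit_add)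
  then show ?thesis by (simp add: D_def)
qed

lemma summable_inverse_odd_power:
  assumes "2 \<le> m"
  shows "summable (\<lambda>k. 1 / (2 * real k + 1) ^ m)"
proof -
  have "summable (\<lambda>n. inverse (real n ^ m))" by (rule inverse_power_summable[OF assms])
  then have "summable (\<lambda>n. inverse (real (n + 1) ^ m))" by (subst summable_iff_shift)
  then show ?thesis
  proof (rule summable_comparison_test'[where N=0])
    fix n :: nat
    show "norm (1 / (2 * real n + 1) ^ m) \<le> inverse (real (n + 1) ^ m)"
      by (auto simp: inverse_eq_divide intro!: frac_le power_mono)
  qed
qed

text \<open>The bounded function \<open>f\<close> is a parameter so that the cosine series and the
  series of derivatives, with \<open>- sin\<close> in place of \<open>cos\<close>, are covered
  alike.\<close>

lemma uniform_limit_alternating_odd_power: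
  fixes f :: "real \<Rightarrow> real"
  assumes "2 \<le> m" and "\<And>z. \<bar>f z\<bar> \<le> 1"
  shows "uniform_limit S (\<lambda>N t. \<Sum>k<N. (-1) ^ k * f ((2 * real k + 1) * t) / (2 * real k + 1) ^ m)
    (\<lambda>t. \<Sum>k. (-1) ^ k * f ((2 * real k + 1) * t) / (2 * real k + 1) ^ m) sequentially"
  using assms(2)
  by (intro Weierstrass_m_test[OF _ summable_inverse_odd_power[OF assms(1)]])
     (simp add: abs_mult power_abs divide_right_mono)

lemma summable_alternating_odd_power:
  fixes f :: "real \<Rightarrow> real"
  assumes "2 \<le> m" and "\<And>z. \<bar>f z\<bar> \<le> 1"
  shows "summable (\<lambda>k. (-1) ^ k * f ((2 * real k + 1) * t) / (2 * real k + 1) ^ m)"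
  using assms(2)
  by (intro summable_comparison_test'[OF summable_inverse_odd_power[OF assms(1)], of 0])
     (simp add: abs_mult power_abs divide_right_mono)

text \<open>These zeros fix the constants of integration at pi / 2 and later make the cosines vanish
  at the barrier.\<close>

lemma cos_odd_half_pi: "cos ((2 * real k + 1) * (pi / 2)) = 0"
  by (subst cos_zero_iff, rule disjI1, rule exI[of _ "2 * k + 1"]) auto

lemma sums_sin_odd_squares:
  assumes "\<bar>t\<bar> < pi / 2"
  shows "(\<lambda>k. (-1) ^ k * sin ((2 * real k + 1) * t) / (2 * real k + 1) ^ 2) sums (pi * t / 4)"
proof -
  \<comment> \<open>The midpoint between |t| and pi / 2: uniform convergence is known only on closed
    intervals strictly inside.\<close>
  define \<rho> where "\<rho> = (\<bar>t\<bar> + pi / 2) / 2"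
  have \<rho>: "0 < \<rho>" "\<rho> < pi / 2" "\<bar>t\<bar> \<le> \<rho>" using assms by (auto simp: \<rho>_def)
  have "(\<lambda>k. (-1) ^ k * sin ((2 * real k + 1) * t) / (2 * real k + 1) ^ 2) sums (pi * t / 4 - pi * 0 / 4 + 0)"
    proof (rule sums_by_antiderivative[where f="\<lambda>k t. (-1) ^ k * sin ((2 * real k + 1) * t) / (2 * real k + 1) ^ 2"
        and G="\<lambda>t. pi * t / 4", OF _ _ uniform_limit_alternating_cos_odd[OF \<rho>(1,2)]], goal_cases)
    case (2 k t)
    show ?case using DERIV_sin_divide_power[of "2 * real k + 1" 2 1] by simp
  qed (use \<rho> in \<open>auto intro!: derivative_eq_intros simp: field_simps power2_eq_square\<close>)
  then show ?thesis by simp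
qed

text \<open>Integrating the sine series determines the sum up to the constant \<open>F 0\<close>.
  The endpoints are reached by continuity, and at pi / 2 all terms vanish, which determines
  \<open>F 0\<close>. Rescaled to the interval from -\<delta> to \<delta>, this is the cosine series
  of \<open>\<delta>\<^sup>2 - y\<^sup>2\<close>.\<close>

lemma sums_cos_odd_cubes:
  assumes "\<bar>t\<bar> \<le> pi / 2"
  shows "(\<lambda>k. (-1) ^ k * cos ((2 * real k + 1) * t) / (2 * real k + 1) ^ 3) sums (pi ^ 3 / 32 - pi * t\<^sup>2 / 8)"
proof -
  define F where "F t = (\<Sum>k. (-1) ^ k * cos ((2 * real k + 1) * t) / (2 * real k + 1) ^ 3)" for t
  have F: "(\<lambda>k. (-1) ^ k * cos ((2 * real k + 1) * t) / (2 * real k + 1) ^ 3) sums F t" for t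
    unfolding F_def by (intro summable_sums summable_alternating_odd_power) auto
  have cont: "continuous_on UNIV F" unfolding F_def
    by (rule uniform_limit_theorem[OF _ uniform_limit_alternating_odd_power])
       (auto intro!: always_eventually continuous_intros)
  have inner: "F s + pi * s\<^sup>2 / 8 = F 0" if "s \<in> {-(pi/2)<..<pi/2}" for s
  proof -
    have ul: "uniform_limit {-(pi/2)<..<pi/2}
      (\<lambda>N t. \<Sum>k<N. (-1) ^ k * (- sin ((2 * real k + 1) * t)) / (2 * real k + 1) ^ 2) (\<lambda>t. - (pi * t / 4)) sequentially"
    proof (rule uniform_limit_cong[THEN iffD1, OF _ _ uniform_limit_alternating_odd_power[where f="\<lambda>z. - sin z" and m=2]])
      fix t :: real assume "t \<in> {-(pi/2)<..<pi/2}"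
      then have "(\<lambda>k. - ((-1) ^ k * sin ((2 * real k + 1) * t) / (2 * real k + 1) ^ 2)) sums - (pi * t / 4)"
        by (intro sums_minus sums_sin_odd_squares) auto
      then show "(\<Sum>k. (-1) ^ k * (- sin ((2 * real k + 1) * t)) / (2 * real k + 1) ^ 2) = - (pi * t / 4)"
        by (simp add: sums_iff)
    qed auto
    have "(\<lambda>k. (-1) ^ k * cos ((2 * real k + 1) * s) / (2 * real k + 1) ^ 3) sums (- (pi * s\<^sup>2 / 8) - (- (pi * 0\<^sup>2 / 8)) + F 0)"
      proof (rule sums_by_antiderivative[where f="\<lambda>k t. (-1) ^ k * cos ((2 * real k + 1) * t) / (2 * real k + 1) ^ 3"
        and G="\<lambda>t. - (pi * t\<^sup>2 / 8)", OF _ _ ul _ F], goal_cases)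
    case (2 k t)
    show ?case by (rule DERIV_cos_divide_power[where m=2]) auto
  qed (use that in \<open>auto intro!: derivative_eq_intros simp: field_simps power2_eq_square power3_eq_cube\<close>)
    then show ?thesis using F[of s] sums_unique2 by fastforce
  qed
  \<comment> \<open>\<open>F\<close> is continuous as a uniform limit, so the identity extends from
    the open interval to its closure.\<close>
  have "F s + pi * s\<^sup>2 / 8 = F 0" if "s \<in> {-(pi/2)..pi/2}" for s
  proof (rule continuous_constant_on_closure[of "{-(pi/2)<..<pi/2}" "\<lambda>s. F s + pi * s\<^sup>2 / 8"])
    show "continuous_on (closure {-(pi/2)<..<pi/2}) (\<lambda>s. F s + pi * s\<^sup>2 / 8)"
      by (intro continuous_intros continuous_on_subset[OF cont]) auto
  qed (use inner that in auto)
  from this[of "pi / 2"] this[of t] have "F t = F (pi / 2) + pi * (pi / 2)\<^sup>2 / 8 - pi * t\<^sup>2 / 8"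
    using assms unfolding abs_le_iff by fastforce
  moreover have "F (pi / 2) = 0" unfolding F_def by (simp only: cos_odd_half_pi) simp
  ultimately show ?thesis using F[of t] by (simp add: power2_eq_square power3_eq_cube mult.assoc)
qed

text \<open>Two further integrations lead from the cubes to the fifth powers, and evaluation at 0
  gives the sum. It supplies the term of the time integral that is free of exponentials.\<close>

lemma sums_inverse_odd_fifth_powers:
  "(\<lambda>k. (-1) ^ k / (2 * real k + 1) ^ 5) sums (5 * pi ^ 5 / 1536)"
proof -
  define S where "S = {-(pi/2)..pi/2}"
  have ul3: "uniform_limit S
      (\<lambda>N t. \<Sum>k<N. (-1) ^ k * cos ((2 * real k + 1) * t) / (2 * real k + 1) ^ 3) (\<lambda>t. pi ^ 3 / 32 - pi * t\<^sup>2 / 8) sequentially"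
    by (rule uniform_limit_cong[THEN iffD1, OF _ _ uniform_limit_alternating_odd_power[where f=cos and m=3]])
       (use sums_cos_odd_cubes in \<open>auto simp: S_def sums_iff abs_le_iff\<close>)
  have F4: "(\<lambda>k. (-1) ^ k * sin ((2 * real k + 1) * s) / (2 * real k + 1) ^ 4) sums
      ((pi ^ 3 * s / 32 - pi * s ^ 3 / 24) - (pi ^ 3 * 0 / 32 - pi * 0 ^ 3 / 24) + 0)" if "s \<in> S" for s
    proof (rule sums_by_antiderivative[where f="\<lambda>k t. (-1) ^ k * sin ((2 * real k + 1) * t) / (2 * real k + 1) ^ 4"
        and G="\<lambda>t. pi ^ 3 * t / 32 - pi * t ^ 3 / 24", OF _ _ ul3 _ _ _ that], goal_cases)
    case (2 k t)
    show ?case by (rule DERIV_sin_divide_power[where m=3]) auto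
  qed (auto simp: S_def intro!: derivative_eq_intros simp: field_simps power2_eq_square power3_eq_cube eval_nat_numeral)
  have ul4: "uniform_limit S
      (\<lambda>N t. \<Sum>k<N. (-1) ^ k * (- sin ((2 * real k + 1) * t)) / (2 * real k + 1) ^ 4)
      (\<lambda>t. - (pi ^ 3 * t / 32 - pi * t ^ 3 / 24)) sequentially"
  proof (rule uniform_limit_cong[THEN iffD1, OF _ _ uniform_limit_alternating_odd_power[where f="\<lambda>z. - sin z" and m=4]])
    fix t assume "t \<in> S"
    from sums_minus[OF F4[OF this]]
    show "(\<Sum>k. (-1) ^ k * (- sin ((2 * real k + 1) * t)) / (2 * real k + 1) ^ 4) = - (pi ^ 3 * t / 32 - pi * t ^ 3 / 24)"
      by (simp add: sums_iff)
  qed auto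
  define G where "G t = - (pi ^ 3 * t\<^sup>2 / 64 - pi * t ^ 4 / 96)" for t :: real
  \<comment> \<open>The base point is pi / 2, where the series is known to vanish; the sum at 0 is
    then \<open>G 0 - G (pi / 2)\<close>.\<close>
  have z: "(\<lambda>k. (-1) ^ k * cos ((2 * real k + 1) * (pi / 2)) / (2 * real k + 1) ^ 5) sums 0"
    by (simp only: cos_odd_half_pi) simp
  have "(\<lambda>k. (-1) ^ k * cos ((2 * real k + 1) * 0) / (2 * real k + 1) ^ 5) sums (G 0 - G (pi / 2) + 0)"
    proof (rule sums_by_antiderivative[where f="\<lambda>k t. (-1) ^ k * cos ((2 * real k + 1) * t) / (2 * real k + 1) ^ 5"
        and G=G, OF _ _ ul4 _ z], goal_cases)
    case (2 k t)
    show ?case by (rule DERIV_cos_divide_power[where m=4]) auto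
  qed (auto simp: S_def G_def[abs_def] intro!: derivative_eq_intros simp: field_simps power2_eq_square power3_eq_cube eval_nat_numeral)
  moreover have "G 0 - G (pi / 2) = 5 * pi ^ 5 / 1536"
    by (simp add: G_def field_simps eval_nat_numeral)
  ultimately show ?thesis by simp
qed

section \<open>Limits along grids\<close>

text \<open>After division by \<sigma>, these are the real and imaginary parts of the characteristic
  function of the standard normal law.\<close>

lemma distributed_normal_cos_sin:
  fixes X :: "'a \<Rightarrow> real"
  assumes "prob_space M" "0 < \<sigma>" "distributed M lborel X (normal_density 0 \<sigma>)"
  shows "(\<integral>\<omega>. cos (a * X \<omega>) \<partial>M) = exp (- ((a * \<sigma>)\<^sup>2 / 2))"
    and "(\<integral>\<omega>. sin (a * X \<omega>) \<partial>M) = 0"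
proof -
  interpret prob_space M by fact
  interpret N: real_distribution std_normal_distribution by (rule real_dist_normal_dist)
  have d: "distributed M lborel (\<lambda>\<omega>. X \<omega> / \<sigma>) std_normal_density"
    using normal_standard_normal_convert[OF assms(2), of X 0] assms(3) by simp
  define b where "b = a * \<sigma>"
  have tr: "(\<integral>\<omega>. g (a * X \<omega>) \<partial>M) = (\<integral>z. g (b * z) \<partial>std_normal_distribution)"
    if [measurable]: "g \<in> borel_measurable borel" for g :: "real \<Rightarrow> real"
  proof -
    have "(\<integral>z. g (b * z) \<partial>std_normal_distribution) = (\<integral>z. std_normal_density z * g (b * z) \<partial>lborel)"
      by (subst integral_density) (auto simp: normal_density_nonneg)
    also have "\<dots> = (\<integral>\<omega>. g (b * (X \<omega> / \<sigma>)) \<partial>M)"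
      by (rule distributed_integral[OF d]) (auto simp: normal_density_nonneg)
    finally show ?thesis using assms(2) by (simp add: b_def)
  qed
  have "(\<integral>z. iexp (b * z) \<partial>std_normal_distribution) = complex_of_real (exp (- (b\<^sup>2) / 2))"
    using fun_cong[OF char_std_normal_distribution, of b] by (simp add: char_def)
  moreover have "integrable std_normal_distribution (\<lambda>z. iexp (b * z))"
    by (rule N.integrable_iexp) auto
  ultimately have "(\<integral>z. Re (iexp (b * z)) \<partial>std_normal_distribution) = exp (- (b\<^sup>2) / 2)"
    "(\<integral>z. Im (iexp (b * z)) \<partial>std_normal_distribution) = 0"
    by (auto simp: integral_Re integral_Im)
  then show "(\<integral>\<omega>. cos (a * X \<omega>) \<partial>M) = exp (- ((a * \<sigma>)\<^sup>2 / 2))" "(\<integral>\<omega>. sin (a * X \<omega>) \<partial>M) = 0"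
    using tr[of cos] tr[of sin] by (auto simp: b_def Re_exp Im_exp)
qed

text \<open>If the path leaves the closed set \<open>C\<close> at some time, it stays outside on a
  neighbourhood, which every sufficiently fine grid meets, so the product is eventually 0. Otherwise
  every factor is 1.\<close>

lemma prod_indicator_grid_tendsto:
  fixes f :: "real \<Rightarrow> real"
  assumes "continuous_on {0..t} f" "0 \<le> t" "closed C"
  shows "(\<lambda>N. \<Prod>j\<le>Suc N. indicator C (f (t * real j / real (Suc N))) :: real)
    \<longlonglongrightarrow> (if \<forall>s\<in>{0..t}. f s \<in> C then 1 else 0)"
proof (cases "\<forall>s\<in>{0..t}. f s \<in> C")
  case True
  have "t * real j / real (Suc N) \<in> {0..t}" if "j \<le> Suc N" for j N
  proof -
    have "t * real j \<le> t * real (Suc N)" using that assms(2) by (intro mult_left_mono) auto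
    then have "t * real j / real (Suc N) \<le> t" by (subst pos_divide_le_eq) auto
    then show ?thesis using assms(2) by auto
  qed
  then have "(\<Prod>j\<le>Suc N. indicator C (f (t * real j / real (Suc N))) :: real) = 1" for N
    using True by (intro prod.neutral) auto
  then show ?thesis using True by simp
next
  case False
  then obtain s where s: "s \<in> {0..t}" "f s \<notin> C" by blast
  obtain d where d: "d > 0" "\<And>r. r \<in> {0..t} \<Longrightarrow> \<bar>r - s\<bar> < d \<Longrightarrow> f r \<notin> C"
  proof -
    have "openin (top_of_set {0..t}) ({0..t} \<inter> f -` (- C))"
      using assms(1,3) by (intro continuous_openin_preimage_gen) auto
    then have "\<forall>x\<in>{0..t} \<inter> f -` (- C). \<exists>e>0. \<forall>x'\<in>{0..t}. dist x' x < e \<longrightarrow> x' \<in> {0..t} \<inter> f -` (- C)"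
      unfolding openin_euclidean_subtopology_iff by (rule conjunct2)
    from bspec[OF this, of s] s obtain d where "d > 0" "\<forall>r\<in>{0..t}. dist r s < d \<longrightarrow> r \<in> {0..t} \<inter> f -` (- C)"
      by auto
    then show ?thesis by (intro that[of d]) (auto simp: dist_real_def)
  qed
  have "(\<lambda>N. t / real (Suc N)) \<longlonglongrightarrow> 0"
    by (rule LIMSEQ_Suc[OF lim_const_over_n])
  then have "\<forall>\<^sub>F N in sequentially. t / real (Suc N) < d" using d(1) by (rule order_tendstoD)
  then have "\<forall>\<^sub>F N in sequentially. (\<Prod>j\<le>Suc N. indicator C (f (t * real j / real (Suc N))) :: real) = 0"
  proof eventually_elim
    case (elim N)
    show ?case
    proof (cases "t = 0")
      case True
      then have "f 0 \<notin> C" using s by auto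
      then show ?thesis by (intro prod_zero) (auto simp: True)
    next
      case False
      then have t: "t > 0" using assms(2) by simp
      \<comment> \<open>The last grid point not after \<open>s\<close>; it is closer to
        \<open>s\<close> than one mesh width.\<close>
      define j where "j = nat \<lfloor>s * real (Suc N) / t\<rfloor>"
      have p: "0 \<le> s * real (Suc N) / t" using s t by auto
      have j: "real j \<le> s * real (Suc N) / t" "s * real (Suc N) / t < real j + 1"
        unfolding j_def using p by linarith+
      have "s * real (Suc N) \<le> t * real (Suc N)" using s by (intro mult_right_mono) auto
      then have "s * real (Suc N) / t \<le> real (Suc N)" using t by (simp only: pos_divide_le_eq mult.commute)
      then have "real j \<le> real (Suc N)" using j by linarith
      then have jN: "j \<le> Suc N" by linarith
      have a: "t * real j / real (Suc N) \<le> s" using j(1) t by (simp add: field_simps del: of_nat_Suc)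
      have "s < t * real j / real (Suc N) + t / real (Suc N)" using j(2) t by (simp add: field_simps del: of_nat_Suc)
      then have "\<bar>t * real j / real (Suc N) - s\<bar> < d" using a elim by linarith
      moreover have "t * real j / real (Suc N) \<in> {0..t}" using a s t by auto
      ultimately have "f (t * real j / real (Suc N)) \<notin> C" using d(2) by blast
      then show ?thesis using jN by (intro prod_zero) (auto intro!: bexI[of _ j])
    qed
  qed
  then show ?thesis using False by (auto intro: tendsto_eventually)
qed

text \<open>Avoiding a level is an open condition, while grid limits need closed sets. By
  compactness a path that avoids the level keeps a positive distance from it, so the closed
  conditions with margin 1/(m+1) exhaust the open one.\<close>

lemma indicator_away_from_level_tendsto:
  fixes f :: "real \<Rightarrow> real"
  assumes "continuous_on {0..t} f" "0 \<le> t"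
  shows "(\<lambda>m. if \<forall>s\<in>{0..t}. f s \<in> {y. \<bar>\<bar>y\<bar> - d\<bar> \<ge> 1 / real (Suc m)} then 1 else 0 :: real)
    \<longlonglongrightarrow> (if \<forall>s\<in>{0..t}. \<bar>f s\<bar> \<noteq> d then 1 else 0)"
proof (cases "\<forall>s\<in>{0..t}. \<bar>f s\<bar> \<noteq> d")
  case True
  have "\<exists>r\<in>{0..t}. \<forall>s\<in>{0..t}. \<bar>\<bar>f r\<bar> - d\<bar> \<le> \<bar>\<bar>f s\<bar> - d\<bar>"
    by (intro continuous_attains_inf continuous_intros assms) (use assms in auto)
  then obtain r where r: "r \<in> {0..t}" "\<And>s. s \<in> {0..t} \<Longrightarrow> \<bar>\<bar>f r\<bar> - d\<bar> \<le> \<bar>\<bar>f s\<bar> - d\<bar>" by blast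
  have "\<bar>\<bar>f r\<bar> - d\<bar> > 0" using True r(1) by auto
  moreover have "(\<lambda>m. 1 / real (Suc m)) \<longlonglongrightarrow> 0" by real_asymp
  ultimately have "\<forall>\<^sub>F m in sequentially. 1 / real (Suc m) < \<bar>\<bar>f r\<bar> - d\<bar>"
    by (rule order_tendstoD(2)[rotated])
  then have "\<forall>\<^sub>F m in sequentially. (if \<forall>s\<in>{0..t}. f s \<in> {y. \<bar>\<bar>y\<bar> - d\<bar> \<ge> 1 / real (Suc m)} then 1 else 0 :: real) = 1"
  proof eventually_elim
    case (elim m)
    then show ?case using r(2) by (auto simp del: of_nat_Suc intro: less_imp_le order.trans)
  qed
  then show ?thesis unfolding if_P[OF True] by (rule tendsto_eventually)
next
  case False
  then obtain s where "s \<in> {0..t}" "\<bar>f s\<bar> = d" by blast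
  then have "\<not> (\<forall>s\<in>{0..t}. f s \<in> {y. \<bar>\<bar>y\<bar> - d\<bar> \<ge> 1 / real (Suc m)})" for m by force
  then have "(if \<forall>s\<in>{0..t}. f s \<in> {y. \<bar>\<bar>y\<bar> - d\<bar> \<ge> 1 / real (Suc m)} then 1 else 0 :: real) = 0" for m by (simp only: if_False)
  then show ?thesis using False by (simp only: if_False tendsto_const)
qed

text \<open>\<open>K N\<close> is the index of the first grid point not before \<sigma>, so the
  weighted sum telescopes to the increment of \<open>f\<close> up to that grid point, and these grid
  points tend to \<sigma> from above.\<close>

lemma telescope_until:
  fixes f :: "real \<Rightarrow> real"
  assumes "0 < T" "0 \<le> \<sigma>" "\<sigma> \<le> T"
  defines "K \<equiv> \<lambda>N. nat \<lceil>\<sigma> * real (Suc N) / T\<rceil>"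
  shows "(\<Sum>i<Suc N. (if T * real i / real (Suc N) < \<sigma> then 1 else 0) *
      (f (T * real (Suc i) / real (Suc N)) - f (T * real i / real (Suc N)))) = f (T * real (K N) / real (Suc N)) - f 0"
    and "T * real (K N) / real (Suc N) \<in> {0..T}"
    and "(\<lambda>N. T * real (K N) / real (Suc N)) \<longlonglongrightarrow> \<sigma>"
proof -
  have p: "0 \<le> \<sigma> * real (Suc N) / T" for N using assms by auto
  have K: "\<sigma> * real (Suc N) / T \<le> real (K N)" "real (K N) < \<sigma> * real (Suc N) / T + 1" for N
    unfolding K_def using p[of N] by linarith+
  have "\<sigma> * real (Suc N) / T \<le> real (Suc N)" for N
    using assms(1) mult_right_mono[OF assms(3), of "real (Suc N)"]
    by (subst pos_divide_le_eq) (auto simp: mult.commute)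
  then have KN: "K N \<le> Suc N" for N unfolding K_def nat_le_iff ceiling_le_iff by simp
  \<comment> \<open>Rounding up is what matches the strict inequality with
    \<open>i < K N\<close>.\<close>
  have iK: "T * real i / real (Suc N) < \<sigma> \<longleftrightarrow> i < K N" for i N
  proof -
    have "T * real i / real (Suc N) < \<sigma> \<longleftrightarrow> real i < \<sigma> * real (Suc N) / T"
      using assms(1) by (simp only: pos_divide_less_eq pos_less_divide_eq of_nat_0_less_iff zero_less_Suc mult.commute)
    also have "\<dots> \<longleftrightarrow> i < K N" unfolding K_def zless_nat_eq_int_zless less_ceiling_iff by simp
    finally show ?thesis .
  qed
  define g where "g i = f (T * real i / real (Suc N))" for i
  have "(\<Sum>i<Suc N. (if T * real i / real (Suc N) < \<sigma> then 1 else 0) * (g (Suc i) - g i))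
      = (\<Sum>i<Suc N. if i \<in> {..<K N} then g (Suc i) - g i else 0)"
    unfolding iK by (intro sum.cong) auto
  also have "\<dots> = (\<Sum>i\<in>{..<Suc N} \<inter> {..<K N}. g (Suc i) - g i)"
    by (rule sum.inter_restrict[symmetric]) simp
  also have "{..<Suc N} \<inter> {..<K N} = {..<K N}" using KN[of N] by auto
  also have "(\<Sum>i\<in>{..<K N}. g (Suc i) - g i) = g (K N) - g 0" by (rule sum_lessThan_telescope)
  finally show "(\<Sum>i<Suc N. (if T * real i / real (Suc N) < \<sigma> then 1 else 0) *
      (f (T * real (Suc i) / real (Suc N)) - f (T * real i / real (Suc N)))) = f (T * real (K N) / real (Suc N)) - f 0"
    by (simp add: g_def)
  have "real (K N) \<le> real (Suc N)" using KN[of N] by (simp only: of_nat_le_iff)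
  then have "T * real (K N) \<le> T * real (Suc N)" using assms(1) by (intro mult_left_mono) auto
  then have "T * real (K N) / real (Suc N) \<le> T" by (simp add: pos_divide_le_eq del: of_nat_Suc)
  then show "T * real (K N) / real (Suc N) \<in> {0..T}" using assms(1) by auto
  show "(\<lambda>N. T * real (K N) / real (Suc N)) \<longlonglongrightarrow> \<sigma>"
  proof (rule tendsto_sandwich)
    show "\<forall>\<^sub>F N in sequentially. \<sigma> \<le> T * real (K N) / real (Suc N)"
    proof (intro always_eventually allI)
      fix N
      have "\<sigma> * real (Suc N) \<le> T * real (K N)"
        using K(1)[of N] assms(1) by (simp only: pos_divide_le_eq mult.commute)
      then show "\<sigma> \<le> T * real (K N) / real (Suc N)" by (subst pos_le_divide_eq) auto
    qed
    show "\<forall>\<^sub>F N in sequentially. T * real (K N) / real (Suc N) \<le> \<sigma> + T / real (Suc N)"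
    proof (intro always_eventually allI)
      fix N
      have "T * real (K N) \<le> T * (\<sigma> * real (Suc N) / T + 1)" using K(2)[of N] assms(1) by (intro mult_left_mono) auto
      also have "\<dots> = (\<sigma> + T / real (Suc N)) * real (Suc N)" using assms(1) by (simp add: distrib_left distrib_right del: of_nat_Suc)
      finally show "T * real (K N) / real (Suc N) \<le> \<sigma> + T / real (Suc N)"
        by (subst pos_divide_le_eq) auto
    qed
    show "(\<lambda>N. \<sigma> + T / real (Suc N)) \<longlonglongrightarrow> \<sigma>" by real_asymp
  qed auto
qed

section \<open>Second-order expansion of the martingale in the frequency\<close>

lemma cos_minus_one_bound: "\<bar>cos z - 1\<bar> \<le> (z::real)\<^sup>2 / 2"
proof -
  have "cos z = 1 - 2 * (sin (z / 2))\<^sup>2" using cos_double_sin[of "z / 2"] by simp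
  moreover have "(sin (z / 2))\<^sup>2 \<le> (z / 2)\<^sup>2"
    using abs_sin_x_le_abs_x[of "z / 2"] by (simp only: abs_le_square_iff)
  ultimately show ?thesis by (simp add: power_divide)
qed

text \<open>The bound is free of \<open>a\<close> and so serves as dominating constant when
  \<open>a\<close> tends to 0. It follows by splitting \<open>exp z * cos (a * y) - 1\<close> into
  \<open>exp z * (cos (a * y) - 1)\<close> and \<open>exp z - 1\<close>, both of order a^2.\<close>

lemma exp_cos_quotient_bound:
  fixes a s y T \<delta> :: real
  assumes "0 < a" "a \<le> 1" "0 \<le> s" "s \<le> T" "\<bar>y\<bar> \<le> \<delta>"
  shows "\<bar>(exp (a\<^sup>2 * s / 2) * cos (a * y) - 1) / (a\<^sup>2 / 2)\<bar> \<le> exp (T / 2) * (\<delta>\<^sup>2 + T)"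
proof -
  define z where "z = a\<^sup>2 * s / 2"
  have a2: "0 < a\<^sup>2" "a\<^sup>2 \<le> 1" using assms by (auto simp: power_le_one)
  have z: "0 \<le> z" "z \<le> T / 2" using assms a2 mult_mono[of "a\<^sup>2" 1 s T] by (auto simp: z_def)
  have e: "exp z \<le> exp (T / 2)" "1 \<le> exp z" using z by auto
  have "1 - z \<le> exp (- z)" using exp_ge_add_one_self[of "- z"] by simp
  then have "(1 - z) * exp z \<le> exp (- z) * exp z" by (intro mult_right_mono) auto
  then have e1: "exp z - 1 \<le> z * exp z" by (simp add: exp_minus algebra_simps)
  also have "\<dots> \<le> (a\<^sup>2 / 2 * T) * exp (T / 2)"
    using z e assms by (intro mult_mono) (auto simp: z_def mult_left_mono)
  finally have e2: "exp z - 1 \<le> (a\<^sup>2 / 2 * T) * exp (T / 2)" .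
  have y2: "y\<^sup>2 \<le> \<delta>\<^sup>2" using assms(5) power_mono[of "\<bar>y\<bar>" \<delta> 2] by simp
  have "\<bar>cos (a * y) - 1\<bar> \<le> a\<^sup>2 / 2 * y\<^sup>2" using cos_minus_one_bound[of "a * y"] by (simp add: power_mult_distrib)
  also have "\<dots> \<le> a\<^sup>2 / 2 * \<delta>\<^sup>2" using y2 by (intro mult_left_mono) auto
  finally have "exp z * \<bar>cos (a * y) - 1\<bar> \<le> exp (T / 2) * (a\<^sup>2 / 2 * \<delta>\<^sup>2)"
    using e by (intro mult_mono) auto
  moreover have "exp z * cos (a * y) - 1 = exp z * (cos (a * y) - 1) + (exp z - 1)" by (simp add: algebra_simps)
  then have "\<bar>exp z * cos (a * y) - 1\<bar> \<le> exp z * \<bar>cos (a * y) - 1\<bar> + (exp z - 1)"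
    using e abs_triangle_ineq[of "exp z * (cos (a * y) - 1)" "exp z - 1"] by (simp add: abs_mult)
  ultimately have "\<bar>exp z * cos (a * y) - 1\<bar> \<le> (exp (T / 2) * (\<delta>\<^sup>2 + T)) * (a\<^sup>2 / 2)"
    using e2 by (simp add: algebra_simps)
  moreover have "\<bar>a\<^sup>2 / 2\<bar> = a\<^sup>2 / 2" by simp
  ultimately show ?thesis unfolding z_def[symmetric] abs_divide using a2
    by (simp only: pos_divide_le_eq half_gt_zero)
qed

text \<open>The limit is the coefficient of a^2 / 2 in the expansion of
  \<open>exp (a\<^sup>2 * s / 2) * cos (a * y)\<close> at 0, taken along a = 1/(n+1).\<close>

lemma exp_cos_quotient_tendsto:
  fixes s y :: real
  assumes "0 \<le> s"
  shows "(\<lambda>n. (exp ((1 / real (Suc n))\<^sup>2 * s / 2) * cos (1 / real (Suc n) * y) - 1) / ((1 / real (Suc n))\<^sup>2 / 2))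
    \<longlonglongrightarrow> s - y\<^sup>2"
proof -
  have e: "((\<lambda>a. (exp (a\<^sup>2 * s / 2) - 1) / (a\<^sup>2 / 2)) \<longlongrightarrow> s) (at_right 0)"
    by (cases "s = 0") (use assms in \<open>simp, real_asymp\<close>)
  \<comment> \<open>As the cosine is even, |y| may replace \<open>y\<close>, which leaves a positive
    constant outside the trivial case.\<close>
  have c: "((\<lambda>a. (cos (a * \<bar>y\<bar>) - 1) / (a\<^sup>2 / 2)) \<longlongrightarrow> - (\<bar>y\<bar>\<^sup>2)) (at_right 0)"
  proof (cases "y = 0")
    case False
    define w where "w = \<bar>y\<bar>"
    have "w > 0" using False by (simp add: w_def)
    then have "((\<lambda>a. (cos (a * w) - 1) / (a\<^sup>2 / 2)) \<longlongrightarrow> - (w * w)) (at_right 0)" by real_asymp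
    then show ?thesis by (simp add: w_def power2_eq_square)
  qed simp
  have e1: "((\<lambda>a. exp (a\<^sup>2 * s / 2)) \<longlongrightarrow> 1) (at_right 0)"
    by (auto intro!: tendsto_eq_intros)
  have "((\<lambda>a. exp (a\<^sup>2 * s / 2) * ((cos (a * \<bar>y\<bar>) - 1) / (a\<^sup>2 / 2)) + (exp (a\<^sup>2 * s / 2) - 1) / (a\<^sup>2 / 2))
      \<longlongrightarrow> 1 * - (\<bar>y\<bar>\<^sup>2) + s) (at_right 0)"
    by (intro tendsto_intros e e1 c)
  moreover have "exp (a\<^sup>2 * s / 2) * ((cos (a * \<bar>y\<bar>) - 1) / (a\<^sup>2 / 2)) + (exp (a\<^sup>2 * s / 2) - 1) / (a\<^sup>2 / 2)
     = (exp (a\<^sup>2 * s / 2) * cos (a * y) - 1) / (a\<^sup>2 / 2)" for a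
    by (cases "y \<ge> 0") (auto simp: add_divide_distrib[symmetric] algebra_simps)
  ultimately have l: "((\<lambda>a. (exp (a\<^sup>2 * s / 2) * cos (a * y) - 1) / (a\<^sup>2 / 2)) \<longlongrightarrow> s - y\<^sup>2) (at_right 0)"
    by simp
  have "filterlim (\<lambda>n. 1 / real (Suc n)) (at_right 0) sequentially" by real_asymp
  from filterlim_compose[OF l this] show ?thesis .
qed

text \<open>The open interval is the form into which the interval integral of \<open>Upsilon\<close>
  unfolds; the two endpoints are null sets.\<close>

lemma has_bochner_integral_FTC_Ioo:
  fixes f F :: "real \<Rightarrow> real"
  assumes "a \<le> b" "\<And>x. a \<le> x \<Longrightarrow> x \<le> b \<Longrightarrow> DERIV F x :> f x" "\<And>x. a \<le> x \<Longrightarrow> x \<le> b \<Longrightarrow> isCont f x"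
    and [measurable]: "f \<in> borel_measurable borel"
  shows "has_bochner_integral lborel (\<lambda>x. indicator {a<..<b} x * f x) (F b - F a)"
proof -
  have "AE x in lborel. f x * indicator {a..b} x = indicator {a<..<b} x * f x"
    using AE_lborel_singleton[of a] AE_lborel_singleton[of b]
    by eventually_elim (auto simp: indicator_def)
  from has_bochner_integral_cong_AE[OF _ _ this] has_bochner_integral_FTC_Icc_real[OF assms(1-3)]
  show ?thesis by auto
qed

section \<open>Increments after a grid event\<close>

context standard_brownian_motion
begin

lemma measurable_at [measurable]: "0 \<le> t \<Longrightarrow> x t \<in> borel_measurable M"
  by (rule random_variables)

text \<open>Grid values relative to \<open>x 0\<close> are partial sums of increments before
  \<open>t\<close>, hence independent of the increment from \<open>t\<close> to \<open>v\<close>.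
  The bounds by 1 make both factors integrable, so the expectation factorises.\<close>

lemma integral_grid_functional_times_increment:
  fixes q h k :: "real \<Rightarrow> real"
  assumes "0 \<le> t" "t < v" "0 < N"
    and [measurable]: "q \<in> borel_measurable borel" "h \<in> borel_measurable borel" "k \<in> borel_measurable borel"
    and b: "\<And>z. \<bar>q z\<bar> \<le> 1" "\<And>z. \<bar>h z\<bar> \<le> 1" "\<And>z. \<bar>k z\<bar> \<le> 1"
  shows "expectation (\<lambda>\<omega>. (\<Prod>j\<le>N. q (x (t * real j / real N) \<omega>)) * h (x t \<omega>) * k (x v \<omega> - x t \<omega>))
     = expectation (\<lambda>\<omega>. (\<Prod>j\<le>N. q (x (t * real j / real N) \<omega>)) * h (x t \<omega>)) * expectation (\<lambda>\<omega>. k (x v \<omega> - x t \<omega>))"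
proof -
  \<comment> \<open>The equidistant grid up to \<open>t\<close>, followed by the single later time
    \<open>v\<close>: increments below index \<open>N\<close> form the past, increment
    \<open>N\<close> is the future one.\<close>
  define tf where "tf i = (if i \<le> N then t * real i / real N else v)" for i
  define X where "X i \<omega> = x (tf (Suc i)) \<omega> - x (tf i) \<omega>" for i \<omega>
  have tf0: "0 \<le> tf i" for i using assms by (auto simp: tf_def)
  have tfN: "tf N = t" "tf (Suc N) = v" using assms by (auto simp: tf_def)
  have mono: "tf i \<le> tf (Suc i)" if "i < Suc N" for i
  proof (cases "i = N")
    case False
    then show ?thesis using that assms by (auto simp: tf_def intro!: divide_right_mono mult_left_mono)
  qed (use tfN assms in auto)
  have ind: "indep_vars (\<lambda>_. borel) X {..<Suc N}"
    using independent_increments[of tf "Suc N"] tf0 mono by (simp add: X_def[abs_def])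
  define Y1 where "Y1 f = (\<Prod>j\<le>N. q (\<Sum>i<j. f i)) * h (\<Sum>i<N. f i)" for f :: "nat \<Rightarrow> real"
  define Y2 where "Y2 f = k (f N)" for f :: "nat \<Rightarrow> real"
  have part [measurable]: "(\<lambda>f. \<Sum>i<j. f i) \<in> borel_measurable (PiM {..<N} (\<lambda>_. borel :: real measure))" if "j \<le> N" for j
    using that by (intro borel_measurable_sum measurable_component_singleton) auto
  have Y1m: "Y1 \<in> borel_measurable (PiM {..<N} (\<lambda>_. borel))"
    unfolding Y1_def[abs_def]
    by (intro borel_measurable_times borel_measurable_prod measurable_compose[OF part]) auto
  have Y2m: "Y2 \<in> borel_measurable (PiM {N} (\<lambda>_. borel))"
    unfolding Y2_def[abs_def] by measurable
  have iv: "indep_var borel (Y1 \<circ> (\<lambda>\<omega>. restrict (\<lambda>i. X i \<omega>) {..<N})) borel (Y2 \<circ> (\<lambda>\<omega>. restrict (\<lambda>i. X i \<omega>) {N}))"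
    by (intro indep_var_compose[OF indep_var_restrict[OF ind] Y1m Y2m]) auto
  have tel: "(\<Sum>i<j. X i \<omega>) = x (tf j) \<omega> - x 0 \<omega>" for j \<omega>
    unfolding X_def by (subst sum_lessThan_telescope) (use assms in \<open>simp add: tf_def\<close>)
  \<comment> \<open>Subtracting \<open>x 0\<close> makes \<open>A\<close> a function of the
    increments on every path; it agrees with the original functional only almost everywhere, where
    \<open>x 0\<close> is 0.\<close>
  define A where "A = (\<lambda>\<omega>. (\<Prod>j\<le>N. q (x (t * real j / real N) \<omega> - x 0 \<omega>)) * h (x t \<omega> - x 0 \<omega>))"
  define B where "B = (\<lambda>\<omega>. k (x v \<omega> - x t \<omega>))"
  have "(\<Sum>i<j. restrict (\<lambda>i. X i \<omega>) {..<N} i) = x (tf j) \<omega> - x 0 \<omega>" if "j \<le> N" for j \<omega>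
    unfolding tel[symmetric] using that by (intro sum.cong) auto
  then have "Y1 \<circ> (\<lambda>\<omega>. restrict (\<lambda>i. X i \<omega>) {..<N}) = A"
    by (auto simp: fun_eq_iff Y1_def A_def tfN(1) tf_def[symmetric] cong: prod.cong)
       (auto simp: tf_def)
  moreover have "Y2 \<circ> (\<lambda>\<omega>. restrict (\<lambda>i. X i \<omega>) {N}) = B"
    by (auto simp: fun_eq_iff Y2_def B_def X_def tfN)
  ultimately have iv: "indep_var borel A borel B" using iv by simp
  have pb: "\<bar>\<Prod>j\<le>N. q (g j)\<bar> \<le> 1" for g :: "nat \<Rightarrow> real"
    unfolding abs_prod using b(1) by (intro prod_le_1) auto
  have tj: "0 \<le> t * real j / real N" for j using assms by auto
  have [measurable]: "x t \<in> borel_measurable M" "x v \<in> borel_measurable M" "x 0 \<in> borel_measurable M"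
    using assms by auto
  have [measurable]: "A \<in> borel_measurable M" "B \<in> borel_measurable M"
    unfolding A_def B_def using tj by measurable
  have "\<bar>A \<omega>\<bar> \<le> 1 * 1" for \<omega>
    unfolding A_def abs_mult by (intro mult_mono pb b) auto
  then have "integrable M A" by (intro integrable_const_bound[of _ 1]) auto
  moreover have "integrable M B" by (intro integrable_const_bound[of _ 1]) (auto simp: B_def b)
  ultimately have AB: "expectation (\<lambda>\<omega>. A \<omega> * B \<omega>) = expectation A * expectation B"
    by (rule indep_var_lebesgue_integral[OF iv])
  have "expectation (\<lambda>\<omega>. (\<Prod>j\<le>N. q (x (t * real j / real N) \<omega>)) * h (x t \<omega>) * k (x v \<omega> - x t \<omega>))
      = expectation (\<lambda>\<omega>. A \<omega> * B \<omega>)"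
    by (intro integral_cong_AE) (use starts_at_zero tj in \<open>auto simp: A_def B_def elim!: eventually_mono\<close>)
  moreover have "expectation (\<lambda>\<omega>. (\<Prod>j\<le>N. q (x (t * real j / real N) \<omega>)) * h (x t \<omega>)) = expectation A"
    by (intro integral_cong_AE) (use starts_at_zero tj in \<open>auto simp: A_def elim!: eventually_mono\<close>)
  ultimately show ?thesis using AB by (simp add: B_def)
qed

text \<open>The indicator that \<open>|x|\<close> does not take the value \<open>\<delta>\<close> up to time \<open>t\<close> is the limit \<open>m \<rightarrow> \<infinity>\<close> of
  \<open>level_avoids\<close>, itself the limit \<open>N \<rightarrow> \<infinity>\<close> of \<open>grid_avoids\<close>, which depends on finitely many increments only.\<close>

definition avoids :: "real \<Rightarrow> real \<Rightarrow> 'a \<Rightarrow> real" where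
  "avoids \<delta> t \<omega> = (if \<forall>s\<in>{0..t}. \<bar>x s \<omega>\<bar> \<noteq> \<delta> then 1 else 0)"

text \<open>The real part of the complex exponential martingale exp (i a x + a^2 t / 2).\<close>

definition exp_mart :: "real \<Rightarrow> real \<Rightarrow> 'a \<Rightarrow> real" where
  "exp_mart a t \<omega> = exp (a\<^sup>2 * t / 2) * cos (a * x t \<omega>)"

definition grid_avoids :: "real \<Rightarrow> real \<Rightarrow> nat \<Rightarrow> nat \<Rightarrow> 'a \<Rightarrow> real" where
  "grid_avoids \<delta> t m N \<omega> = (\<Prod>j\<le>Suc N. indicator {y. \<bar>\<bar>y\<bar> - \<delta>\<bar> \<ge> 1 / real (Suc m)} (x (t * real j / real (Suc N)) \<omega>))"

definition level_avoids :: "real \<Rightarrow> real \<Rightarrow> nat \<Rightarrow> 'a \<Rightarrow> real" where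
  "level_avoids \<delta> t m \<omega> = (if \<forall>s\<in>{0..t}. x s \<omega> \<in> {y. \<bar>\<bar>y\<bar> - \<delta>\<bar> \<ge> 1 / real (Suc m)} then 1 else 0)"

lemma closed_level: "closed {y::real. \<bar>\<bar>y\<bar> - \<delta>\<bar> \<ge> e}"
  by (intro closed_Collect_le continuous_intros)

lemma continuous_path: "\<omega> \<in> space M \<Longrightarrow> continuous_on {0..t} (\<lambda>s. x s \<omega>)"
  using continuous_on_subset[OF continuous_paths] by auto

lemma grid_avoids_tendsto:
  assumes "\<omega> \<in> space M" "0 \<le> t"
  shows "(\<lambda>N. grid_avoids \<delta> t m N \<omega>) \<longlonglongrightarrow> level_avoids \<delta> t m \<omega>"
  unfolding grid_avoids_def level_avoids_def
  by (rule prod_indicator_grid_tendsto[OF continuous_path[OF assms(1)] assms(2) closed_level])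

lemma level_avoids_tendsto:
  assumes "\<omega> \<in> space M" "0 \<le> t"
  shows "(\<lambda>m. level_avoids \<delta> t m \<omega>) \<longlonglongrightarrow> avoids \<delta> t \<omega>"
  unfolding level_avoids_def avoids_def
  by (rule indicator_away_from_level_tendsto[OF continuous_path[OF assms(1)] assms(2)])

lemma measurable_grid_avoids [measurable]:
  assumes "0 \<le> t" shows "grid_avoids \<delta> t m N \<in> borel_measurable M"
proof -
  have tj: "0 \<le> t * real j / real (Suc N)" for j using assms by auto
  have [measurable]: "{y. \<bar>\<bar>y\<bar> - \<delta>\<bar> \<ge> 1 / real (Suc m)} \<in> sets borel" 
    by (intro borel_closed closed_level)
  show ?thesis unfolding grid_avoids_def[abs_def]
    by (intro borel_measurable_prod measurable_compose[OF measurable_at[OF tj]]) measurable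
qed

lemma measurable_level_avoids [measurable]:
  assumes "0 \<le> t" shows "level_avoids \<delta> t m \<in> borel_measurable M"
  by (rule borel_measurable_LIMSEQ_real[where u="grid_avoids \<delta> t m"])
     (use grid_avoids_tendsto assms in auto)

text \<open>The event restricts uncountably many times; it becomes measurable as a pointwise limit
  over margins of limits over grids, by continuity of every path.\<close>

lemma measurable_avoids [measurable]:
  assumes "0 \<le> t" shows "avoids \<delta> t \<in> borel_measurable M"
  by (rule borel_measurable_LIMSEQ_real[where u="level_avoids \<delta> t"])
     (use level_avoids_tendsto assms in auto)

lemma measurable_exp_mart [measurable]:
  assumes "0 \<le> t" shows "exp_mart a t \<in> borel_measurable M"
  unfolding exp_mart_def[abs_def] using assms by measurable

lemma abs_exp_mart_le: "\<bar>exp_mart a t \<omega>\<bar> \<le> exp (a\<^sup>2 * t / 2)"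
  unfolding exp_mart_def abs_mult by (simp add: mult_left_le)

lemma abs_exp_mart_le': "t \<le> T \<Longrightarrow> \<bar>exp_mart a t \<omega>\<bar> \<le> exp (a\<^sup>2 * T / 2)"
  by (rule order.trans[OF abs_exp_mart_le]) (simp add: mult_left_mono)

text \<open>The martingale property tested against a grid event. In the addition formula for the
  cosine at time \<open>v\<close> the sine of the increment has mean 0, and the mean of its cosine
  is exactly compensated by the growth of the exponential factor.\<close>

lemma expectation_grid_avoids_exp_mart:
  assumes "0 \<le> t" "t < v"
  shows "expectation (\<lambda>\<omega>. grid_avoids \<delta> t m N \<omega> * (exp_mart a v \<omega> - exp_mart a t \<omega>)) = 0"
proof -
  define q :: "real \<Rightarrow> real" where "q = indicator {y. \<bar>\<bar>y\<bar> - \<delta>\<bar> \<ge> 1 / real (Suc m)}"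
  define g where "g = grid_avoids \<delta> t m N"
  have g: "g \<omega> = (\<Prod>j\<le>Suc N. q (x (t * real j / real (Suc N)) \<omega>))" for \<omega>
    by (simp add: g_def grid_avoids_def q_def)
  have qm: "q \<in> borel_measurable borel" unfolding q_def
    by (intro borel_measurable_indicator borel_closed closed_level)
  have qb: "\<bar>q z\<bar> \<le> 1" for z by (simp add: q_def indicator_def)
  have gb: "\<bar>g \<omega>\<bar> \<le> 1" for \<omega>
    unfolding g abs_prod using qb by (intro prod_le_1) auto
  have gm [measurable]: "g \<in> borel_measurable M" using assms by (simp add: g_def)
  have [measurable]: "x t \<in> borel_measurable M" "x v \<in> borel_measurable M" using assms by auto
  define D where "D \<omega> = x v \<omega> - x t \<omega>" for \<omega>
  have [measurable]: "D \<in> borel_measurable M" unfolding D_def[abs_def] by measurable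
  have int3: "integrable M (\<lambda>\<omega>. g \<omega> * p (x t \<omega>) * k (D \<omega>))"
    if [measurable]: "p \<in> borel_measurable borel" "k \<in> borel_measurable borel"
      and "\<And>z. \<bar>p z\<bar> \<le> 1" "\<And>z. \<bar>k z\<bar> \<le> 1" for p k :: "real \<Rightarrow> real"
  proof (rule integrable_const_bound[of _ 1])
    have "\<bar>g \<omega> * p (x t \<omega>) * k (D \<omega>)\<bar> \<le> 1 * 1 * 1" for \<omega>
      unfolding abs_mult by (intro mult_mono gb that) auto
    then show "AE \<omega> in M. norm (g \<omega> * p (x t \<omega>) * k (D \<omega>)) \<le> 1" by simp
  qed measurable
  have d: "distributed M lborel D (normal_density 0 (sqrt (v - t)))"
    unfolding D_def using gaussian_increments assms by auto
  have cD: "expectation (\<lambda>\<omega>. cos (a * D \<omega>)) = exp (- (a\<^sup>2 * (v - t) / 2))"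
    and sD: "expectation (\<lambda>\<omega>. sin (a * D \<omega>)) = 0"
    using distributed_normal_cos_sin[OF prob_space_axioms _ d, of a] assms by (auto simp: power_mult_distrib)
  have c: "expectation (\<lambda>\<omega>. g \<omega> * cos (a * x t \<omega>) * cos (a * D \<omega>)) = expectation (\<lambda>\<omega>. g \<omega> * cos (a * x t \<omega>)) * exp (- (a\<^sup>2 * (v - t) / 2))"
    unfolding cD[symmetric] unfolding g D_def
    by (rule integral_grid_functional_times_increment[OF assms, of "Suc N" q "\<lambda>z. cos (a * z)" "\<lambda>z. cos (a * z)"])
       (use qm qb in auto)
  have s: "expectation (\<lambda>\<omega>. g \<omega> * sin (a * x t \<omega>) * sin (a * D \<omega>)) = expectation (\<lambda>\<omega>. g \<omega> * sin (a * x t \<omega>)) * 0"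
    unfolding sD[symmetric] unfolding g D_def
    by (rule integral_grid_functional_times_increment[OF assms, of "Suc N" q "\<lambda>z. sin (a * z)" "\<lambda>z. sin (a * z)"])
       (use qm qb in auto)
  have i1: "integrable M (\<lambda>\<omega>. g \<omega> * cos (a * x t \<omega>) * cos (a * D \<omega>))"
    by (rule int3[of "\<lambda>z. cos (a * z)" "\<lambda>z. cos (a * z)"]) auto
  have i2: "integrable M (\<lambda>\<omega>. g \<omega> * sin (a * x t \<omega>) * sin (a * D \<omega>))"
    by (rule int3[of "\<lambda>z. sin (a * z)" "\<lambda>z. sin (a * z)"]) auto
  have i3: "integrable M (\<lambda>\<omega>. g \<omega> * cos (a * x t \<omega>))"
    using int3[of "\<lambda>z. cos (a * z)" "\<lambda>z. 1"] by auto
  have "(\<lambda>\<omega>. g \<omega> * (exp_mart a v \<omega> - exp_mart a t \<omega>)) = (\<lambda>\<omega>. exp (a\<^sup>2 * v / 2) *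
        (g \<omega> * cos (a * x t \<omega>) * cos (a * D \<omega>) - g \<omega> * sin (a * x t \<omega>) * sin (a * D \<omega>))
        - exp (a\<^sup>2 * t / 2) * (g \<omega> * cos (a * x t \<omega>)))"
  proof
    fix \<omega>
    have "a * x v \<omega> = a * x t \<omega> + a * D \<omega>" by (simp add: D_def algebra_simps)
    then show "g \<omega> * (exp_mart a v \<omega> - exp_mart a t \<omega>) = exp (a\<^sup>2 * v / 2) *
        (g \<omega> * cos (a * x t \<omega>) * cos (a * D \<omega>) - g \<omega> * sin (a * x t \<omega>) * sin (a * D \<omega>))
        - exp (a\<^sup>2 * t / 2) * (g \<omega> * cos (a * x t \<omega>))"
      unfolding exp_mart_def by (simp only: cos_add) (simp add: algebra_simps)
  qed
  then have "expectation (\<lambda>\<omega>. g \<omega> * (exp_mart a v \<omega> - exp_mart a t \<omega>)) =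
      exp (a\<^sup>2 * v / 2) * (expectation (\<lambda>\<omega>. g \<omega> * cos (a * x t \<omega>)) * exp (- (a\<^sup>2 * (v - t) / 2)) - 0)
      - exp (a\<^sup>2 * t / 2) * expectation (\<lambda>\<omega>. g \<omega> * cos (a * x t \<omega>))"
    using i1 i2 i3 c s by (simp add: Bochner_Integration.integral_diff)
  also have "\<dots> = (exp (a\<^sup>2 * v / 2) * exp (- (a\<^sup>2 * (v - t) / 2)) - exp (a\<^sup>2 * t / 2)) * expectation (\<lambda>\<omega>. g \<omega> * cos (a * x t \<omega>))"
    by (simp add: algebra_simps)
  also have "exp (a\<^sup>2 * v / 2) * exp (- (a\<^sup>2 * (v - t) / 2)) = exp (a\<^sup>2 * t / 2)"
    unfolding exp_add[symmetric] by (simp add: field_simps)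
  finally show ?thesis by (simp add: g_def)
qed

text \<open>Two passages to the limit by dominated convergence, first in the mesh \<open>N\<close>
  and then in the margin \<open>m\<close>, with the same constant bound.\<close>

lemma expectation_avoids_exp_mart:
  assumes "0 \<le> t" "t < v"
  shows "expectation (\<lambda>\<omega>. avoids \<delta> t \<omega> * (exp_mart a v \<omega> - exp_mart a t \<omega>)) = 0"
proof -
  define Z where "Z \<omega> = exp_mart a v \<omega> - exp_mart a t \<omega>" for \<omega>
  define C where "C = 2 * exp (a\<^sup>2 * v / 2)"
  have v: "0 \<le> v" using assms by simp
  have Zm [measurable]: "Z \<in> borel_measurable M" unfolding Z_def[abs_def] using assms v by measurable
  have Zb: "\<bar>Z \<omega>\<bar> \<le> C" for \<omega>
    using abs_exp_mart_le'[of t v a \<omega>] abs_exp_mart_le'[of v v a \<omega>] assms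
    unfolding Z_def C_def by linarith
  have b: "norm (r * Z \<omega>) \<le> C" if "\<bar>r\<bar> \<le> 1" for r \<omega>
    using mult_mono[OF that Zb[of \<omega>]] by (simp add: abs_mult)
  have gb: "\<bar>grid_avoids \<delta> t m N \<omega>\<bar> \<le> 1" for m N \<omega>
    unfolding grid_avoids_def abs_prod by (intro prod_le_1) (auto simp: indicator_def)
  have lb: "\<bar>level_avoids \<delta> t m \<omega>\<bar> \<le> 1" for m \<omega> by (simp add: level_avoids_def)
  have l: "expectation (\<lambda>\<omega>. level_avoids \<delta> t m \<omega> * Z \<omega>) = 0" for m
  proof -
    have "(\<lambda>N. expectation (\<lambda>\<omega>. grid_avoids \<delta> t m N \<omega> * Z \<omega>)) \<longlonglongrightarrow> expectation (\<lambda>\<omega>. level_avoids \<delta> t m \<omega> * Z \<omega>)"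
      by (rule integral_dominated_convergence[where w="\<lambda>_. C"])
         (use assms b gb in \<open>auto intro!: AE_I2 tendsto_mult grid_avoids_tendsto\<close>)
    moreover have "expectation (\<lambda>\<omega>. grid_avoids \<delta> t m N \<omega> * Z \<omega>) = 0" for N
      unfolding Z_def by (rule expectation_grid_avoids_exp_mart[OF assms])
    ultimately show ?thesis by (simp add: LIMSEQ_const_iff)
  qed
  have "(\<lambda>m. expectation (\<lambda>\<omega>. level_avoids \<delta> t m \<omega> * Z \<omega>)) \<longlonglongrightarrow> expectation (\<lambda>\<omega>. avoids \<delta> t \<omega> * Z \<omega>)"
    by (rule integral_dominated_convergence[where w="\<lambda>_. C"])
       (use assms b lb in \<open>auto intro!: AE_I2 tendsto_mult level_avoids_tendsto\<close>)
  then show ?thesis unfolding l by (simp add: LIMSEQ_const_iff Z_def)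
qed


section \<open>Stopping at the exit time\<close>


definition stop :: "real \<Rightarrow> real \<Rightarrow> 'a \<Rightarrow> real" where
  "stop \<delta> T \<omega> = real_of_ereal (min (exit_time x \<delta> \<omega>) (ereal T))"

text \<open>By continuity the set of hitting times is closed, so a nonempty one contains its
  infimum: the exit time is attained.\<close>

lemma exit_time_cases:
  assumes "\<omega> \<in> space M"
  obtains (never) "exit_time x \<delta> \<omega> = \<infinity>" "\<And>t. 0 \<le> t \<Longrightarrow> \<bar>x t \<omega>\<bar> \<noteq> \<delta>"
  | (hits) s where "0 \<le> s" "exit_time x \<delta> \<omega> = ereal s" "\<bar>x s \<omega>\<bar> = \<delta>"
      "\<And>t. 0 \<le> t \<Longrightarrow> t < s \<Longrightarrow> \<bar>x t \<omega>\<bar> \<noteq> \<delta>"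
proof -
  define S where "S = {t. 0 \<le> t \<and> \<bar>x t \<omega>\<bar> = \<delta>}"
  have ex: "exit_time x \<delta> \<omega> = Inf (ereal ` S)" by (simp add: exit_time_def S_def)
  show thesis
  proof (cases "S = {}")
    case True
    show thesis
    proof (rule never)
      show "exit_time x \<delta> \<omega> = \<infinity>" unfolding ex True by (simp add: top_ereal_def)
    qed (use True in \<open>auto simp: S_def\<close>)
  next
    case False
    have "closed ({0..} \<inter> (\<lambda>t. \<bar>x t \<omega>\<bar>) -` {\<delta>})"
      using continuous_paths[OF assms] by (intro continuous_closed_preimage continuous_intros) auto
    moreover have "S = {0..} \<inter> (\<lambda>t. \<bar>x t \<omega>\<bar>) -` {\<delta>}" by (auto simp: S_def)
    ultimately have "closed S" by simp
    moreover have bdd: "bdd_below S" by (rule bdd_belowI[of _ 0]) (auto simp: S_def)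
    ultimately have I: "Inf S \<in> S" using False by (intro closed_contains_Inf)
    have "exit_time x \<delta> \<omega> = ereal (Inf S)"
      unfolding ex using I bdd by (intro antisym INF_lower INF_greatest) (auto intro: cInf_lower)
    moreover have "\<bar>x t \<omega>\<bar> \<noteq> \<delta>" if "0 \<le> t" "t < Inf S" for t
      using cInf_lower[OF _ bdd, of t] that by (auto simp: S_def)
    ultimately show thesis using I by (intro hits[of "Inf S"]) (auto simp: S_def)
  qed
qed

lemma stop_bounds:
  assumes "\<omega> \<in> space M" "0 \<le> T"
  shows "0 \<le> stop \<delta> T \<omega>" "stop \<delta> T \<omega> \<le> T"
  by (rule exit_time_cases[OF assms(1), of \<delta>]; use assms in \<open>simp add: stop_def min_def\<close>)+

lemma min_exit_time:
  assumes "\<omega> \<in> space M"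
  shows "min (exit_time x \<delta> \<omega>) (ereal T) = ereal (stop \<delta> T \<omega>)"
  by (rule exit_time_cases[OF assms(1), of \<delta>]; simp add: stop_def min_def)

text \<open>The strict bound \<open>t < T\<close> matters: at \<open>t = T\<close> the left side is
  false even for paths that never reach the barrier.\<close>

lemma less_stop_iff:
  assumes "\<omega> \<in> space M" "0 \<le> t" "t < T"
  shows "t < stop \<delta> T \<omega> \<longleftrightarrow> (\<forall>s\<in>{0..t}. \<bar>x s \<omega>\<bar> \<noteq> \<delta>)"
proof (rule exit_time_cases[OF assms(1), of \<delta>])
  fix s assume s: "0 \<le> s" "exit_time x \<delta> \<omega> = ereal s" "\<bar>x s \<omega>\<bar> = \<delta>" "\<And>t. 0 \<le> t \<Longrightarrow> t < s \<Longrightarrow> \<bar>x t \<omega>\<bar> \<noteq> \<delta>"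
  have "stop \<delta> T \<omega> = min s T" using s(2) by (simp add: stop_def min_def)
  then show ?thesis using s assms by (auto simp: not_less)
qed (use assms in \<open>auto simp: stop_def min_def\<close>)

lemma avoids_eq_less_stop:
  assumes "\<omega> \<in> space M" "0 \<le> t" "t < T"
  shows "avoids \<delta> t \<omega> = (if t < stop \<delta> T \<omega> then 1 else 0)"
  using less_stop_iff[OF assms] by (simp add: avoids_def)

text \<open>A hit exactly at time \<open>T\<close> falls under the second case, because
  \<open>avoids\<close> looks at the closed interval.\<close>

lemma abs_at_stop:
  assumes "\<omega> \<in> space M" "0 \<le> T"
  shows "avoids \<delta> T \<omega> = 1 \<and> stop \<delta> T \<omega> = T \<or> avoids \<delta> T \<omega> = 0 \<and> \<bar>x (stop \<delta> T \<omega>) \<omega>\<bar> = \<delta>"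
proof (rule exit_time_cases[OF assms(1), of \<delta>])
  fix s assume s: "0 \<le> s" "exit_time x \<delta> \<omega> = ereal s" "\<bar>x s \<omega>\<bar> = \<delta>" "\<And>t. 0 \<le> t \<Longrightarrow> t < s \<Longrightarrow> \<bar>x t \<omega>\<bar> \<noteq> \<delta>"
  have "stop \<delta> T \<omega> = min s T" using s(2) by (simp add: stop_def min_def)
  then show ?thesis using s assms by (cases "T < s") (auto simp: avoids_def)
qed (use assms in \<open>auto simp: stop_def min_def avoids_def\<close>)

lemma stop_min:
  assumes "\<omega> \<in> space M" "r \<le> T"
  shows "stop \<delta> r \<omega> = min r (stop \<delta> T \<omega>)"
  by (rule exit_time_cases[OF assms(1), of \<delta>]; use assms in \<open>simp add: stop_def min_def\<close>)

text \<open>A path from 0 that lies beyond \<delta> at time \<open>r\<close> must, by the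
  intermediate value theorem, have met the barrier strictly earlier.\<close>

lemma abs_le_before_stop:
  assumes "\<omega> \<in> space M" "x 0 \<omega> = 0" "0 < \<delta>" "0 \<le> T" "0 \<le> r" "r \<le> stop \<delta> T \<omega>"
  shows "\<bar>x r \<omega>\<bar> \<le> \<delta>"
proof (rule ccontr)
  assume *: "\<not> \<bar>x r \<omega>\<bar> \<le> \<delta>"
  have "\<exists>s\<ge>0. s \<le> r \<and> \<bar>x s \<omega>\<bar> = \<delta>"
    using continuous_path[OF assms(1), of r] assms * by (intro IVT') (auto intro!: continuous_intros)
  then obtain s where s: "0 \<le> s" "s \<le> r" "\<bar>x s \<omega>\<bar> = \<delta>" by blast
  then have "s \<noteq> r" using * by auto
  then have "s < stop \<delta> T \<omega>" using s assms by auto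
  then show False
    using less_stop_iff[OF assms(1) s(1), of T \<delta>] s stop_bounds[OF assms(1,4), of \<delta>] by auto
qed

section \<open>Optional stopping through sums over grids\<close>

text \<open>The weight at a left grid point says that this point lies before the stopping time, so
  the sum telescopes. The second claim shows each sum to be a single increment of \<open>f\<close>,
  which gives bounds independent of \<open>N\<close>.\<close>

lemma stopped_sum_tendsto:
  fixes f :: "real \<Rightarrow> real"
  assumes "\<omega> \<in> space M" "0 < T" "continuous_on {0..T} f"
  shows "(\<lambda>N. \<Sum>i<Suc N. avoids \<delta> (T * real i / real (Suc N)) \<omega> *
      (f (T * real (Suc i) / real (Suc N)) - f (T * real i / real (Suc N)))) \<longlonglongrightarrow> f (stop \<delta> T \<omega>) - f 0"
    and "\<And>N. \<exists>r\<in>{0..T}. (\<Sum>i<Suc N. avoids \<delta> (T * real i / real (Suc N)) \<omega> *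
      (f (T * real (Suc i) / real (Suc N)) - f (T * real i / real (Suc N)))) = f r - f 0"
proof -
  define \<sigma> where "\<sigma> = stop \<delta> T \<omega>"
  have \<sigma>: "0 \<le> \<sigma>" "\<sigma> \<le> T" using stop_bounds assms by (auto simp: \<sigma>_def)
  define K where "K N = nat \<lceil>\<sigma> * real (Suc N) / T\<rceil>" for N
  note tu = telescope_until[OF assms(2) \<sigma>, folded K_def]
  have av: "avoids \<delta> (T * real i / real (Suc N)) \<omega> = (if T * real i / real (Suc N) < \<sigma> then 1 else 0)"
    if "i < Suc N" for i N
  proof -
    have "T * real i < T * real (Suc N)" using that assms(2) by (intro mult_strict_left_mono) auto
    then have "T * real i / real (Suc N) < T" by (subst pos_divide_less_eq) auto
    then show ?thesis unfolding \<sigma>_def using assms by (intro avoids_eq_less_stop) auto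
  qed
  have eq: "(\<Sum>i<Suc N. avoids \<delta> (T * real i / real (Suc N)) \<omega> *
      (f (T * real (Suc i) / real (Suc N)) - f (T * real i / real (Suc N)))) = f (T * real (K N) / real (Suc N)) - f 0" for N
    unfolding tu(1)[of N f, symmetric] by (intro sum.cong refl) (simp only: av lessThan_iff)
  show "\<exists>r\<in>{0..T}. (\<Sum>i<Suc N. avoids \<delta> (T * real i / real (Suc N)) \<omega> *
      (f (T * real (Suc i) / real (Suc N)) - f (T * real i / real (Suc N)))) = f r - f 0" for N
    unfolding eq using tu(2)[of N] by blast
  have "(\<lambda>N. f (T * real (K N) / real (Suc N))) \<longlonglongrightarrow> f \<sigma>"
    by (rule continuous_on_tendsto_compose[OF assms(3) tu(3)]) (use \<sigma> tu(2) in auto)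
  then show "(\<lambda>N. \<Sum>i<Suc N. avoids \<delta> (T * real i / real (Suc N)) \<omega> *
      (f (T * real (Suc i) / real (Suc N)) - f (T * real i / real (Suc N)))) \<longlonglongrightarrow> f (stop \<delta> T \<omega>) - f 0"
    unfolding eq \<sigma>_def by (intro tendsto_diff tendsto_const)
qed

text \<open>The stopped value minus the initial value is a pointwise limit of the grid sums, which
  involve only fixed times.\<close>

lemma measurable_stopped:
  assumes "0 < T" "\<And>t. 0 \<le> t \<Longrightarrow> Y t \<in> borel_measurable M"
    and "\<And>\<omega>. \<omega> \<in> space M \<Longrightarrow> continuous_on {0..T} (\<lambda>t. Y t \<omega> :: real)"
  shows "(\<lambda>\<omega>. Y (stop \<delta> T \<omega>) \<omega>) \<in> borel_measurable M"
proof -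
  have tj: "0 \<le> T * real j / real (Suc N)" for j N using assms by auto
  have "(\<lambda>\<omega>. Y (stop \<delta> T \<omega>) \<omega> - Y 0 \<omega>) \<in> borel_measurable M"
  proof (rule borel_measurable_LIMSEQ_real)
    fix \<omega> assume "\<omega> \<in> space M"
    then show "(\<lambda>N. \<Sum>i<Suc N. avoids \<delta> (T * real i / real (Suc N)) \<omega> *
      (Y (T * real (Suc i) / real (Suc N)) \<omega> - Y (T * real i / real (Suc N)) \<omega>))
      \<longlonglongrightarrow> Y (stop \<delta> T \<omega>) \<omega> - Y 0 \<omega>"
      by (intro stopped_sum_tendsto(1) assms)
  qed (intro borel_measurable_sum borel_measurable_times borel_measurable_diff measurable_avoids assms(2) tj)
  then have "(\<lambda>\<omega>. (Y (stop \<delta> T \<omega>) \<omega> - Y 0 \<omega>) + Y 0 \<omega>) \<in> borel_measurable M"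
    using assms(2) by (intro borel_measurable_add) auto
  then show ?thesis by simp
qed

lemma measurable_stop [measurable]: "0 < T \<Longrightarrow> stop \<delta> T \<in> borel_measurable M"
  using measurable_stopped[of T "\<lambda>t _. t"] by (auto intro: continuous_intros)

lemma measurable_at_stop [measurable]: "0 < T \<Longrightarrow> (\<lambda>\<omega>. x (stop \<delta> T \<omega>) \<omega>) \<in> borel_measurable M"
  by (rule measurable_stopped) (auto intro: continuous_path)

text \<open>Every summand of the grid sums has mean 0, and the sums are bounded by \<open>C\<close>
  and converge to the stopped increment. Hence the stopped value has the mean of the initial value,
  which is 1 almost everywhere.\<close>

lemma expectation_stopped_exp_mart:
  assumes "0 < T"
  shows "expectation (\<lambda>\<omega>. exp_mart a (stop \<delta> T \<omega>) \<omega>) = 1"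
proof -
  define C where "C = 2 * exp (a\<^sup>2 * T / 2)"
  have cont: "continuous_on {0..T} (\<lambda>t. exp_mart a t \<omega>)" if "\<omega> \<in> space M" for \<omega>
    unfolding exp_mart_def by (intro continuous_intros continuous_path that) auto
  have tj: "0 \<le> T * real j / real (Suc N)" for j N using assms by auto
  have [measurable]: "(\<lambda>\<omega>. exp_mart a (stop \<delta> T \<omega>) \<omega>) \<in> borel_measurable M"
    by (rule measurable_stopped) (use assms cont in auto)
  have bd: "\<bar>exp_mart a t \<omega> - exp_mart a 0 \<omega>\<bar> \<le> C" if "0 \<le> t" "t \<le> T" for t \<omega>
    using abs_exp_mart_le'[of t T a \<omega>] abs_exp_mart_le'[of 0 T a \<omega>] that assms unfolding C_def by linarith
  define S where "S N \<omega> = (\<Sum>i<Suc N. avoids \<delta> (T * real i / real (Suc N)) \<omega> *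
      (exp_mart a (T * real (Suc i) / real (Suc N)) \<omega> - exp_mart a (T * real i / real (Suc N)) \<omega>))" for N \<omega>
  have [measurable]: "S N \<in> borel_measurable M" for N
    unfolding S_def[abs_def]
    using tj by (intro borel_measurable_sum borel_measurable_times borel_measurable_diff measurable_avoids measurable_exp_mart)
  have "(\<lambda>N. expectation (S N)) \<longlonglongrightarrow> expectation (\<lambda>\<omega>. exp_mart a (stop \<delta> T \<omega>) \<omega> - exp_mart a 0 \<omega>)"
  proof (rule integral_dominated_convergence[where w="\<lambda>_. C"])
    show "AE \<omega> in M. norm (S N \<omega>) \<le> C" for N
    proof (rule AE_I2)
      fix \<omega> assume "\<omega> \<in> space M"
      from stopped_sum_tendsto(2)[OF this assms cont[OF this], where N=N and \<delta>=\<delta>] obtain r where "r \<in> {0..T}" "S N \<omega> = exp_mart a r \<omega> - exp_mart a 0 \<omega>"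
        unfolding S_def by blast
      then show "norm (S N \<omega>) \<le> C" using bd by auto
    qed
    show "AE \<omega> in M. (\<lambda>N. S N \<omega>) \<longlonglongrightarrow> exp_mart a (stop \<delta> T \<omega>) \<omega> - exp_mart a 0 \<omega>"
      unfolding S_def using stopped_sum_tendsto(1)[OF _ assms cont] by (intro AE_I2) auto
  qed auto
  moreover have "expectation (S N) = 0" for N
  proof -
    have lt: "T * real i / real (Suc N) < T * real (Suc i) / real (Suc N)" for i
      using assms by (intro divide_strict_right_mono mult_strict_left_mono) auto
    \<comment> \<open>The increment between neighbouring grid points is compared with the value at
      time 0 twice, hence the factor 2.\<close>
    have int: "integrable M (\<lambda>\<omega>. avoids \<delta> (T * real i / real (Suc N)) \<omega> *
      (exp_mart a (T * real (Suc i) / real (Suc N)) \<omega> - exp_mart a (T * real i / real (Suc N)) \<omega>))" if "i < Suc N" for i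
    proof (rule integrable_const_bound[of _ "2 * C"])
      have "T * real (Suc i) \<le> T * real (Suc N)" using that assms(1) by (intro mult_left_mono) auto
      then have le: "T * real (Suc i) / real (Suc N) \<le> T" by (subst pos_divide_le_eq) auto
      have "\<bar>avoids \<delta> (T * real i / real (Suc N)) \<omega> *
        (exp_mart a (T * real (Suc i) / real (Suc N)) \<omega> - exp_mart a (T * real i / real (Suc N)) \<omega>)\<bar> \<le> 1 * (2 * C)" for \<omega>
        unfolding abs_mult
        using bd[OF tj le, of \<omega>] bd[OF tj order.trans[OF less_imp_le[OF lt] le], of \<omega>]
        by (intro mult_mono) (auto simp: avoids_def simp del: of_nat_Suc)
      then show "AE \<omega> in M. norm (avoids \<delta> (T * real i / real (Suc N)) \<omega> *
        (exp_mart a (T * real (Suc i) / real (Suc N)) \<omega> - exp_mart a (T * real i / real (Suc N)) \<omega>)) \<le> 2 * C" by simp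
    qed (use tj in \<open>intro borel_measurable_times borel_measurable_diff measurable_avoids measurable_exp_mart\<close>)
    show ?thesis unfolding S_def
      by (subst Bochner_Integration.integral_sum)
         (use int expectation_avoids_exp_mart[OF tj lt] in \<open>auto simp del: of_nat_Suc\<close>)
  qed
  ultimately have z: "expectation (\<lambda>\<omega>. exp_mart a (stop \<delta> T \<omega>) \<omega> - exp_mart a 0 \<omega>) = 0"
    by (simp add: LIMSEQ_const_iff)
  have "expectation (\<lambda>\<omega>. exp_mart a (stop \<delta> T \<omega>) \<omega> - exp_mart a 0 \<omega>)
      = expectation (\<lambda>\<omega>. exp_mart a (stop \<delta> T \<omega>) \<omega>) - expectation (\<lambda>\<omega>. exp_mart a 0 \<omega>)"
  proof (rule Bochner_Integration.integral_diff)
    show "integrable M (\<lambda>\<omega>. exp_mart a (stop \<delta> T \<omega>) \<omega>)"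
      using stop_bounds assms by (intro integrable_const_bound[of _ "exp (a\<^sup>2 * T / 2)"] AE_I2) (auto intro: abs_exp_mart_le')
    show "integrable M (\<lambda>\<omega>. exp_mart a 0 \<omega>)"
      using assms by (intro integrable_const_bound[of _ "exp (a\<^sup>2 * T / 2)"] AE_I2) (auto intro: abs_exp_mart_le')
  qed
  moreover have "expectation (\<lambda>\<omega>. exp_mart a 0 \<omega>) = expectation (\<lambda>\<omega>. 1)"
    by (intro integral_cong_AE) (use starts_at_zero in \<open>auto simp: exp_mart_def elim!: eventually_mono\<close>)
  ultimately show ?thesis using z by (simp add: prob_space)
qed

text \<open>Wald's second identity. The quotients \<open>g n\<close> have mean 0, are uniformly
  bounded almost everywhere and tend to the stopping time minus the square of the stopped
  value.\<close>

lemma expectation_stop_eq_square: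
  assumes "0 < T" "0 < \<delta>"
  shows "expectation (stop \<delta> T) = expectation (\<lambda>\<omega>. (x (stop \<delta> T \<omega>) \<omega>)\<^sup>2)"
proof -
  define a where "a n = 1 / real (Suc n)" for n
  define g where "g n \<omega> = (exp_mart (a n) (stop \<delta> T \<omega>) \<omega> - 1) / ((a n)\<^sup>2 / 2)" for n \<omega>
  have [measurable]: "stop \<delta> T \<in> borel_measurable M" "(\<lambda>\<omega>. x (stop \<delta> T \<omega>) \<omega>) \<in> borel_measurable M"
    using assms by auto
  have em [measurable]: "(\<lambda>\<omega>. exp_mart b (stop \<delta> T \<omega>) \<omega>) \<in> borel_measurable M" for b
    unfolding exp_mart_def by measurable
  have [measurable]: "g n \<in> borel_measurable M" for n unfolding g_def[abs_def] by measurable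
  have i: "integrable M (\<lambda>\<omega>. exp_mart b (stop \<delta> T \<omega>) \<omega>)" for b
    using stop_bounds assms by (intro integrable_const_bound[of _ "exp (b\<^sup>2 * T / 2)"] AE_I2) (auto intro: abs_exp_mart_le')
  have g0: "expectation (g n) = 0" for n
    unfolding g_def using i expectation_stopped_exp_mart[OF assms(1)] by (simp add: prob_space)
  have good: "AE \<omega> in M. \<omega> \<in> space M \<and> \<bar>x (stop \<delta> T \<omega>) \<omega>\<bar> \<le> \<delta>"
    using starts_at_zero AE_space
  proof eventually_elim
    case (elim \<omega>)
    then show ?case using abs_le_before_stop[of \<omega> \<delta> T "stop \<delta> T \<omega>"] stop_bounds[of \<omega> T] assms by auto
  qed
  have "(\<lambda>n. expectation (g n)) \<longlonglongrightarrow> expectation (\<lambda>\<omega>. stop \<delta> T \<omega> - (x (stop \<delta> T \<omega>) \<omega>)\<^sup>2)"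
  proof (rule integral_dominated_convergence[where w="\<lambda>_. exp (T / 2) * (\<delta>\<^sup>2 + T)"])
    show "AE \<omega> in M. norm (g n \<omega>) \<le> exp (T / 2) * (\<delta>\<^sup>2 + T)" for n
      using good
    proof eventually_elim
      case (elim \<omega>)
      then show ?case unfolding g_def exp_mart_def real_norm_def using assms stop_bounds[of \<omega> T]
        by (intro exp_cos_quotient_bound) (auto simp: a_def)
    qed
    show "AE \<omega> in M. (\<lambda>n. g n \<omega>) \<longlonglongrightarrow> stop \<delta> T \<omega> - (x (stop \<delta> T \<omega>) \<omega>)\<^sup>2"
      unfolding g_def exp_mart_def a_def using assms stop_bounds[of _ T]
      by (intro AE_I2 exp_cos_quotient_tendsto) auto
  qed auto
  then have "expectation (\<lambda>\<omega>. stop \<delta> T \<omega> - (x (stop \<delta> T \<omega>) \<omega>)\<^sup>2) = 0"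
    unfolding g0 by (simp add: LIMSEQ_const_iff)
  moreover have "integrable M (stop \<delta> T)"
    using stop_bounds assms by (intro integrable_const_bound[of _ T] AE_I2) auto
  moreover have "integrable M (\<lambda>\<omega>. (x (stop \<delta> T \<omega>) \<omega>)\<^sup>2)"
    using good power_mono[of "\<bar>_\<bar>" \<delta> 2] by (intro integrable_const_bound[of _ "\<delta>\<^sup>2"]) (auto elim!: eventually_mono)
  ultimately show ?thesis by simp
qed

section \<open>The survival term and its series\<close>

text \<open>The function called A in the overview.\<close>

definition surv :: "real \<Rightarrow> real \<Rightarrow> real" where
  "surv \<delta> t = expectation (\<lambda>\<omega>. avoids \<delta> t \<omega> * (\<delta>\<^sup>2 - (x t \<omega>)\<^sup>2))"

lemma avoids_imp_abs_less:
  assumes "\<omega> \<in> space M" "x 0 \<omega> = 0" "0 < \<delta>" "0 \<le> t" "avoids \<delta> t \<omega> \<noteq> 0"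
  shows "\<bar>x t \<omega>\<bar> < \<delta>"
proof -
  have "stop \<delta> t \<omega> = t" using abs_at_stop[OF assms(1,4), of \<delta>] assms(5) by auto
  then have "\<bar>x t \<omega>\<bar> \<le> \<delta>" using abs_le_before_stop[OF assms(1-4), of t] assms(4) by simp
  moreover have "\<bar>x t \<omega>\<bar> \<noteq> \<delta>" using assms(4,5) by (auto simp: avoids_def split: if_splits)
  ultimately show ?thesis by linarith
qed

text \<open>With these frequencies the cosine vanishes at both barriers, so only paths without exit
  up to \<open>T\<close> contribute to the stopped martingale, and for them the stopping time is
  \<open>T\<close>.\<close>

lemma expectation_avoids_cos:
  assumes "0 < T" "0 < \<delta>"
  defines "a \<equiv> \<lambda>k. (2 * real k + 1) * pi / (2 * \<delta>)"
  shows "expectation (\<lambda>\<omega>. avoids \<delta> T \<omega> * cos (a k * x T \<omega>)) = exp (- ((a k)\<^sup>2 * T / 2))"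
proof -
  have "exp_mart (a k) (stop \<delta> T \<omega>) \<omega> = exp ((a k)\<^sup>2 * T / 2) * (avoids \<delta> T \<omega> * cos (a k * x T \<omega>))"
    if "\<omega> \<in> space M" for \<omega>
    using abs_at_stop[OF that less_imp_le[OF assms(1)], of \<delta>]
  proof
    assume "avoids \<delta> T \<omega> = 0 \<and> \<bar>x (stop \<delta> T \<omega>) \<omega>\<bar> = \<delta>"
    moreover have "cos (a k * \<delta>) = 0"
      using cos_odd_half_pi[of k] assms(2) by (simp add: a_def)
    moreover have "cos (a k * y) = cos (a k * \<bar>y\<bar>)" for y by (simp add: abs_if)
    ultimately show ?thesis unfolding exp_mart_def by (metis mult_zero_left mult_zero_right)
  qed (auto simp: exp_mart_def)
  then have "expectation (\<lambda>\<omega>. exp_mart (a k) (stop \<delta> T \<omega>) \<omega>) =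
      expectation (\<lambda>\<omega>. exp ((a k)\<^sup>2 * T / 2) * (avoids \<delta> T \<omega> * cos (a k * x T \<omega>)))"
    by (intro Bochner_Integration.integral_cong) auto
  then have "1 = exp ((a k)\<^sup>2 * T / 2) * expectation (\<lambda>\<omega>. avoids \<delta> T \<omega> * cos (a k * x T \<omega>))"
    using expectation_stopped_exp_mart[OF assms(1)] by simp
  then show ?thesis by (simp add: exp_minus field_simps)
qed

text \<open>The cosine series of \<open>\<delta>\<^sup>2 - y\<^sup>2\<close> is inserted and
  integrated term by term; its coefficients decay like the inverse cube of 2k + 1, so the
  interchange is justified by absolute summability.\<close>

lemma surv_sums:
  assumes "0 < t" "0 < \<delta>"
  shows "(\<lambda>k. 32 * \<delta>\<^sup>2 / pi ^ 3 * ((-1) ^ k / (2 * real k + 1) ^ 3)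
      * exp (- (((2 * real k + 1) * pi / (2 * \<delta>))\<^sup>2 * t / 2))) sums surv \<delta> t"
proof -
  define a where "a k = (2 * real k + 1) * pi / (2 * \<delta>)" for k
  define c where "c k = 32 * \<delta>\<^sup>2 / pi ^ 3 * ((-1) ^ k / (2 * real k + 1) ^ 3)" for k
  define f where "f k \<omega> = c k * (avoids \<delta> t \<omega> * cos (a k * x t \<omega>))" for k \<omega>
  define B where "B k = 32 * \<delta>\<^sup>2 / pi ^ 3 * (1 / (2 * real k + 1) ^ 3)" for k
  have [measurable]: "x t \<in> borel_measurable M" "avoids \<delta> t \<in> borel_measurable M" using assms by auto
  have fm [measurable]: "f k \<in> borel_measurable M" for k unfolding f_def[abs_def] by measurable
  have sB: "summable B" unfolding B_def by (intro summable_mult summable_inverse_odd_power) simp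
  have cB: "\<bar>c k\<bar> = B k" for k by (simp add: c_def B_def abs_mult power_abs)
  have fB: "\<bar>f k \<omega>\<bar> \<le> B k" for k \<omega>
  proof -
    have "\<bar>avoids \<delta> t \<omega>\<bar> * \<bar>cos (a k * x t \<omega>)\<bar> \<le> 1 * 1"
      by (intro mult_mono) (auto simp: avoids_def)
    then show ?thesis unfolding f_def abs_mult cB using cB[of k] by (simp add: mult_left_le)
  qed
  have fi: "integrable M (f k)" for k
    using fB by (intro integrable_const_bound[of _ "B k"]) auto
  have ae: "AE \<omega> in M. summable (\<lambda>k. norm (f k \<omega>))"
    using fB by (intro AE_I2 summable_comparison_test'[OF sB]) auto
  have ni: "expectation (\<lambda>\<omega>. norm (f k \<omega>)) \<le> B k" for k
    using integral_mono[OF integrable_norm[OF fi[of k]], of "\<lambda>_. B k"] fB by (simp add: prob_space)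
  have si: "summable (\<lambda>k. expectation (\<lambda>\<omega>. norm (f k \<omega>)))"
    using ni by (intro summable_comparison_test'[OF sB]) (auto intro!: Bochner_Integration.integral_nonneg)
  have "(\<lambda>k. expectation (f k)) sums expectation (\<lambda>\<omega>. \<Sum>k. f k \<omega>)"
    by (rule sums_integral[OF fi ae si])
  moreover have "expectation (f k) = c k * exp (- ((a k)\<^sup>2 * t / 2))" for k
    using expectation_avoids_cos[OF assms, of k, folded a_def] by (simp add: f_def[abs_def])
  moreover have "expectation (\<lambda>\<omega>. \<Sum>k. f k \<omega>) = surv \<delta> t"
    unfolding surv_def
  proof (rule integral_cong_AE)
    show "AE \<omega> in M. (\<Sum>k. f k \<omega>) = avoids \<delta> t \<omega> * (\<delta>\<^sup>2 - (x t \<omega>)\<^sup>2)"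
      using starts_at_zero AE_space
    proof eventually_elim
      case (elim \<omega>)
      show ?case
      proof (cases "avoids \<delta> t \<omega> = 0")
        case False
        define y where "y = x t \<omega>"
        have y: "\<bar>y\<bar> < \<delta>" using avoids_imp_abs_less[OF elim(2,1) assms(2) less_imp_le[OF assms(1)] False] by (simp add: y_def)
        \<comment> \<open>This rescaling carries the interval from -\<delta> to \<delta> to that
          from -pi / 2 to pi / 2.\<close>
        define th where "th = pi * y / (2 * \<delta>)"
        have "\<bar>th\<bar> \<le> pi / 2" using y assms(2) by (simp add: th_def abs_mult field_simps)
        note s = sums_mult[OF sums_cos_odd_cubes[OF this], of "32 * \<delta>\<^sup>2 / pi ^ 3"]
        have "32 * \<delta>\<^sup>2 / pi ^ 3 * (pi ^ 3 / 32 - pi * th\<^sup>2 / 8) = \<delta>\<^sup>2 - y\<^sup>2"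
          using assms(2) by (simp add: th_def field_simps power2_eq_square power3_eq_cube)
        moreover have "32 * \<delta>\<^sup>2 / pi ^ 3 * ((-1) ^ k * cos ((2 * real k + 1) * th) / (2 * real k + 1) ^ 3) = c k * cos (a k * y)" for k
          by (simp add: c_def a_def th_def mult_ac)
        ultimately have "(\<lambda>k. c k * cos (a k * y)) sums (\<delta>\<^sup>2 - y\<^sup>2)" using s by simp
        moreover have "avoids \<delta> t \<omega> = 1" using False by (metis avoids_def)
        ultimately show ?thesis by (simp add: f_def y_def sums_iff)
      qed (simp add: f_def)
    qed
  qed measurable
  ultimately show ?thesis by (simp add: c_def a_def)
qed

lemma integrable_avoids:
  assumes "0 < T" "0 < \<delta>"
  shows "integrable M (\<lambda>\<omega>. avoids \<delta> T \<omega> * (\<delta>\<^sup>2 - (x T \<omega>)\<^sup>2))"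
proof -
  have [measurable]: "x T \<in> borel_measurable M" "avoids \<delta> T \<in> borel_measurable M" using assms by auto
  show ?thesis
  proof (rule integrable_const_bound[of _ "\<delta>\<^sup>2"])
    show "AE \<omega> in M. norm (avoids \<delta> T \<omega> * (\<delta>\<^sup>2 - (x T \<omega>)\<^sup>2)) \<le> \<delta>\<^sup>2"
      using starts_at_zero AE_space
    proof eventually_elim
      case (elim \<omega>)
      show ?case
      proof (cases "avoids \<delta> T \<omega> = 0")
        case False
        have "\<bar>x T \<omega>\<bar> < \<delta>" using avoids_imp_abs_less[OF elim(2,1) assms(2) less_imp_le[OF assms(1)] False] .
        then have "(x T \<omega>)\<^sup>2 \<le> \<delta>\<^sup>2" using power_mono[of "\<bar>x T \<omega>\<bar>" \<delta> 2] by simp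
        moreover have "avoids \<delta> T \<omega> = 1" using False by (metis avoids_def)
        ultimately show ?thesis by simp
      qed simp
    qed
  qed measurable
qed

text \<open>The squared stopped value is \<delta>^2 after an exit and the square at time
  \<open>T\<close> otherwise, so it is \<delta>^2 minus the integrand of
  \<open>surv\<close>.\<close>

lemma expectation_stop:
  assumes "0 < T" "0 < \<delta>"
  shows "expectation (stop \<delta> T) = \<delta>\<^sup>2 - surv \<delta> T"
proof -
  have "(x (stop \<delta> T \<omega>) \<omega>)\<^sup>2 = \<delta>\<^sup>2 - avoids \<delta> T \<omega> * (\<delta>\<^sup>2 - (x T \<omega>)\<^sup>2)" if "\<omega> \<in> space M" for \<omega>
    using abs_at_stop[OF that less_imp_le[OF assms(1)], of \<delta>]
  proof
    assume *: "avoids \<delta> T \<omega> = 0 \<and> \<bar>x (stop \<delta> T \<omega>) \<omega>\<bar> = \<delta>"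
    have "(x (stop \<delta> T \<omega>) \<omega>)\<^sup>2 = \<delta>\<^sup>2" using * power2_abs[of "x (stop \<delta> T \<omega>) \<omega>"] by simp
    then show ?thesis using * by simp
  qed simp
  then have "expectation (\<lambda>\<omega>. (x (stop \<delta> T \<omega>) \<omega>)\<^sup>2) = expectation (\<lambda>\<omega>. \<delta>\<^sup>2 - avoids \<delta> T \<omega> * (\<delta>\<^sup>2 - (x T \<omega>)\<^sup>2))"
    by (intro Bochner_Integration.integral_cong) auto
  also have "\<dots> = \<delta>\<^sup>2 - surv \<delta> T" unfolding surv_def using integrable_avoids[OF assms] by (simp add: prob_space)
  finally show ?thesis using expectation_stop_eq_square[OF assms] by simp
qed


section \<open>Integration over time\<close>


text \<open>Rounding time down to multiples of 1/(N+1) leaves countably many measurable pieces, and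
  continuity gives convergence as \<open>N\<close> grows. Negative times are mapped to 0
  throughout.\<close>

lemma measurable_path_joint [measurable]:
  "(\<lambda>p. x (max 0 (fst p)) (snd p)) \<in> borel_measurable (lborel \<Otimes>\<^sub>M M)"
proof (rule borel_measurable_LIMSEQ_real)
  define u where "u N p = x (max 0 (real_of_int \<lfloor>fst p * real (Suc N)\<rfloor> / real (Suc N))) (snd p)"
    for N and p :: "real \<times> 'a"
  show "u N \<in> borel_measurable (lborel \<Otimes>\<^sub>M M)" for N
    unfolding u_def[abs_def]
  proof (rule measurable_compose_countable[where f="\<lambda>i p. x (max 0 (real_of_int i / real (Suc N))) (snd p)"
        and g="\<lambda>p. \<lfloor>fst p * real (Suc N)\<rfloor>"])
    show "(\<lambda>p. x (max 0 (real_of_int i / real (Suc N))) (snd p)) \<in> borel_measurable (lborel \<Otimes>\<^sub>M M)" for i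
      by (rule measurable_compose[OF measurable_snd measurable_at]) simp
    show "(\<lambda>p. \<lfloor>fst p * real (Suc N)\<rfloor>) \<in> measurable (lborel \<Otimes>\<^sub>M M) (count_space UNIV)"
      by measurable
  qed
  fix p :: "real \<times> 'a" assume "p \<in> space (lborel \<Otimes>\<^sub>M M)"
  then have w: "snd p \<in> space M" by (auto simp: space_pair_measure)
  have "(\<lambda>N. real_of_int \<lfloor>fst p * real (Suc N)\<rfloor> / real (Suc N)) \<longlonglongrightarrow> fst p"
  proof (rule tendsto_sandwich)
    show "\<forall>\<^sub>F N in sequentially. fst p - 1 / real (Suc N) \<le> real_of_int \<lfloor>fst p * real (Suc N)\<rfloor> / real (Suc N)"
    proof (intro always_eventually allI)
      fix N
      have "fst p * real (Suc N) - 1 \<le> real_of_int \<lfloor>fst p * real (Suc N)\<rfloor>" by linarith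
      then have "(fst p * real (Suc N) - 1) / real (Suc N) \<le> real_of_int \<lfloor>fst p * real (Suc N)\<rfloor> / real (Suc N)"
        by (intro divide_right_mono) auto
      then show "fst p - 1 / real (Suc N) \<le> real_of_int \<lfloor>fst p * real (Suc N)\<rfloor> / real (Suc N)"
        by (simp only: diff_divide_distrib) (simp del: of_nat_Suc)
    qed
    show "\<forall>\<^sub>F N in sequentially. real_of_int \<lfloor>fst p * real (Suc N)\<rfloor> / real (Suc N) \<le> fst p"
    proof (intro always_eventually allI)
      fix N
      show "real_of_int \<lfloor>fst p * real (Suc N)\<rfloor> / real (Suc N) \<le> fst p"
        by (subst pos_divide_le_eq) (auto simp del: of_nat_Suc)
    qed
    have "(\<lambda>N. fst p - 1 / real (Suc N)) \<longlonglongrightarrow> fst p - 0"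
      by (intro tendsto_diff tendsto_const LIMSEQ_Suc[OF lim_const_over_n])
    then show "(\<lambda>N. fst p - 1 / real (Suc N)) \<longlonglongrightarrow> fst p" by simp
  qed auto
  then have "(\<lambda>N. max 0 (real_of_int \<lfloor>fst p * real (Suc N)\<rfloor> / real (Suc N))) \<longlonglongrightarrow> max 0 (fst p)"
    by (intro tendsto_max tendsto_const)
  then show "(\<lambda>N. u N p) \<longlonglongrightarrow> x (max 0 (fst p)) (snd p)"
    unfolding u_def by (intro continuous_on_tendsto_compose[OF continuous_paths[OF w]]) auto
qed

text \<open>Each exponential is integrated separately; division by its rate \<open>b k\<close>
  raises the exponent of 2k + 1 from 3 to 5. The contributions at time 0 add up through the closed
  sum of inverse fifth powers.\<close>

lemma has_bochner_integral_surv: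
  assumes "0 < T" "0 < \<delta>"
  shows "has_bochner_integral lborel (\<lambda>r. indicator {0<..<T} r * surv \<delta> r)
    (5 * \<delta> ^ 4 / 6 - 256 * \<delta> ^ 4 / pi ^ 5 *
      (\<Sum>k. (-1) ^ k * exp (- ((2 * real k + 1)\<^sup>2 * (T * pi\<^sup>2 / (8 * \<delta>\<^sup>2)))) / (2 * real k + 1) ^ 5))"
proof -
  define c where "c k = 32 * \<delta>\<^sup>2 / pi ^ 3 * ((-1) ^ k / (2 * real k + 1) ^ 3)" for k
  define b where "b k = ((2 * real k + 1) * pi / (2 * \<delta>))\<^sup>2 / 2" for k
  define f where "f k r = indicator {0<..<T} r * (c k * exp (- (b k * r)))" for k r
  define B where "B k = 32 * \<delta>\<^sup>2 / pi ^ 3 * (1 / (2 * real k + 1) ^ 3)" for k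
  define e where "e k = exp (- ((2 * real k + 1)\<^sup>2 * (T * pi\<^sup>2 / (8 * \<delta>\<^sup>2))))" for k
  have [measurable]: "f k \<in> borel_measurable borel" for k unfolding f_def[abs_def] by measurable
  have b0: "b k > 0" for k using assms(2) by (auto simp: b_def)
  have hf: "has_bochner_integral lborel (f k) (c k / b k * (1 - exp (- (b k * T))))" for k
  proof -
    have "has_bochner_integral lborel (f k) (- (c k / b k * exp (- (b k * T))) - - (c k / b k * exp (- (b k * 0))))"
      unfolding f_def[abs_def]
      by (rule has_bochner_integral_FTC_Ioo[where F="\<lambda>r. - (c k / b k * exp (- (b k * r)))"])
         (use assms b0[of k] in \<open>auto intro!: derivative_eq_intros continuous_intros\<close>)
    then show ?thesis by (simp add: algebra_simps)
  qed
  have sB: "summable B" unfolding B_def by (intro summable_mult summable_inverse_odd_power) simp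
  have B0: "0 \<le> B k" for k by (simp add: B_def)
  have cB: "\<bar>c k\<bar> = B k" for k by (simp add: c_def B_def abs_mult power_abs)
  have fB: "\<bar>f k r\<bar> \<le> B k * indicator {0<..<T} r" for k r
    using b0[of k] B0[of k] by (auto simp: f_def abs_mult cB indicator_def mult_left_le)
  have iI: "integrable lborel (\<lambda>r. B k * indicator {0<..<T} r :: real)" for k
    using assms by (intro integrable_mult_right integrable_real_indicator) auto
  have "\<bar>f k r\<bar> \<le> B k" for k r using fB[of k r] B0[of k] by (cases "r \<in> {0<..<T}") auto
  then have ae: "AE r in lborel. summable (\<lambda>k. norm (f k r))"
    by (intro AE_I2 summable_comparison_test'[OF sB]) auto
  have "(LINT r|lborel. norm (f k r)) \<le> B k * T" for k
  proof -
    have "(LINT r|lborel. norm (f k r)) \<le> (LINT r|lborel. B k * indicator {0<..<T} r)"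
      using hf[of k] fB by (intro integral_mono iI integrable_norm) (auto simp: has_bochner_integral_iff)
    then show ?thesis using assms by simp
  qed
  then have si: "summable (\<lambda>k. LINT r|lborel. norm (f k r))"
    by (intro summable_comparison_test'[OF summable_mult2[OF sB, of T], of 0]) auto
  have fi: "integrable lborel (f k)" for k using hf[of k] by (simp add: has_bochner_integral_iff)
  have ptw: "(\<Sum>k. f k r) = indicator {0<..<T} r * surv \<delta> r" for r
  proof (cases "r \<in> {0<..<T}")
    case True
    have "32 * \<delta>\<^sup>2 / pi ^ 3 * ((-1) ^ k / (2 * real k + 1) ^ 3)
      * exp (- (((2 * real k + 1) * pi / (2 * \<delta>))\<^sup>2 * r / 2)) = f k r" for k
      using True by (simp add: f_def c_def b_def)
    then show ?thesis using surv_sums[OF _ assms(2), of r] True by (simp add: sums_iff)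
  qed (simp add: f_def)
  have int: "integrable lborel (\<lambda>r. indicator {0<..<T} r * surv \<delta> r)"
    using integrable_suminf[OF fi ae si] by (simp add: ptw)
  have "(\<lambda>k. LINT r|lborel. f k r) sums (LINT r|lborel. indicator {0<..<T} r * surv \<delta> r)"
    using sums_integral[OF fi ae si] by (simp add: ptw)
  moreover have "(LINT r|lborel. f k r) = 256 * \<delta> ^ 4 / pi ^ 5 * ((-1) ^ k / (2 * real k + 1) ^ 5 - (-1) ^ k * e k / (2 * real k + 1) ^ 5)" for k
  proof -
    have "b k * T = (2 * real k + 1)\<^sup>2 * (T * pi\<^sup>2 / (8 * \<delta>\<^sup>2))"
      using assms by (simp add: b_def power_divide power_mult_distrib)
    then have "exp (- (b k * T)) = e k" by (simp add: e_def)
    moreover have "c k / b k = 256 * \<delta> ^ 4 / pi ^ 5 * ((-1) ^ k / (2 * real k + 1) ^ 5)"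
    proof -
      define n where "n = 2 * real k + 1"
      have "n > 0" by (simp add: n_def)
      then show ?thesis unfolding c_def b_def n_def[symmetric] using assms
        by (simp add: field_simps eval_nat_numeral)
    qed
    moreover have "(LINT r|lborel. f k r) = c k / b k * (1 - exp (- (b k * T)))"
      by (rule has_bochner_integral_integral_eq[OF hf])
    ultimately have "(LINT r|lborel. f k r) = 256 * \<delta> ^ 4 / pi ^ 5 * ((-1) ^ k / (2 * real k + 1) ^ 5) * (1 - e k)"
      by (simp only:)
    moreover have "(-1) ^ k * e k / (2 * real k + 1) ^ 5 = (-1) ^ k / (2 * real k + 1) ^ 5 * e k" by simp
    ultimately show ?thesis by (simp only: right_diff_distrib mult_1_right mult.assoc)
  qed
  moreover have "(\<lambda>k. 256 * \<delta> ^ 4 / pi ^ 5 * ((-1) ^ k / (2 * real k + 1) ^ 5 - (-1) ^ k * e k / (2 * real k + 1) ^ 5))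
     sums (256 * \<delta> ^ 4 / pi ^ 5 * (5 * pi ^ 5 / 1536 - (\<Sum>k. (-1) ^ k * e k / (2 * real k + 1) ^ 5)))"
  proof (intro sums_mult sums_diff sums_inverse_odd_fifth_powers summable_sums)
    have "e k \<le> 1" for k using assms by (simp add: e_def)
    then show "summable (\<lambda>k. (-1) ^ k * e k / (2 * real k + 1) ^ 5)"
      by (intro summable_comparison_test'[OF summable_inverse_odd_power[of 5], of 0])
         (auto simp: abs_mult power_abs e_def intro!: divide_right_mono)
  qed
  ultimately have "(LINT r|lborel. indicator {0<..<T} r * surv \<delta> r) =
      256 * \<delta> ^ 4 / pi ^ 5 * (5 * pi ^ 5 / 1536 - (\<Sum>k. (-1) ^ k * e k / (2 * real k + 1) ^ 5))"
    using sums_unique2 by simp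
  also have "\<dots> = 5 * \<delta> ^ 4 / 6 - 256 * \<delta> ^ 4 / pi ^ 5 * (\<Sum>k. (-1) ^ k * e k / (2 * real k + 1) ^ 5)"
    by (simp add: right_diff_distrib)
  finally show ?thesis using int by (simp add: has_bochner_integral_iff e_def)
qed

section \<open>The payoff as a time integral\<close>

text \<open>Kept literally as the integrand of \<open>Upsilon\<close>, whose value is therefore its
  expectation by unfolding.\<close>

definition payoff :: "real \<Rightarrow> real \<Rightarrow> real \<Rightarrow> 'a \<Rightarrow> real" where
  "payoff \<delta> T \<alpha> \<omega> = (LBINT s = 0..min (exit_time x \<delta> \<omega>) (ereal T). (x s \<omega>)\<^sup>2)
            + \<alpha> * (real_of_ereal (max (ereal T - exit_time x \<delta> \<omega>) 0))\<^sup>2"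

text \<open>The random upper limit moves into the integrand, which leaves the fixed interval from 0
  to \<open>T\<close> and an integrand measurable in time and path jointly.\<close>

lemma payoff_eq:
  assumes "\<omega> \<in> space M" "0 < T"
  shows "payoff \<delta> T \<alpha> \<omega> =
    (LINT r|lborel. indicator {0<..<T} r * (if r < stop \<delta> T \<omega> then (x (max 0 r) \<omega>)\<^sup>2 else 0)) + \<alpha> * (T - stop \<delta> T \<omega>)\<^sup>2"
proof -
  define \<sigma> where "\<sigma> = stop \<delta> T \<omega>"
  have \<sigma>: "0 \<le> \<sigma>" "\<sigma> \<le> T" using stop_bounds[OF assms(1), of T \<delta>] assms(2) by (auto simp: \<sigma>_def)
  have "(LBINT s = 0..min (exit_time x \<delta> \<omega>) (ereal T). (x s \<omega>)\<^sup>2) = (LINT r|lborel. indicator {0<..<\<sigma>} r * (x r \<omega>)\<^sup>2)"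
    unfolding min_exit_time[OF assms(1)] \<sigma>_def[symmetric] interval_lebesgue_integral_def set_lebesgue_integral_def
    using \<sigma> by (simp add: zero_ereal_def)
  also have "\<dots> = (LINT r|lborel. indicator {0<..<T} r * (if r < \<sigma> then (x (max 0 r) \<omega>)\<^sup>2 else 0))"
    using \<sigma> by (intro Bochner_Integration.integral_cong) (auto simp: indicator_def)
  finally have 1: "(LBINT s = 0..min (exit_time x \<delta> \<omega>) (ereal T). (x s \<omega>)\<^sup>2) = \<dots>" .
  \<comment> \<open>For an infinite exit time the difference is minus infinity, so the maximum is 0,
    in accordance with \<sigma> = \<open>T\<close>.\<close>
  have 2: "real_of_ereal (max (ereal T - exit_time x \<delta> \<omega>) 0) = T - \<sigma>"
  proof (rule exit_time_cases[OF assms(1), of \<delta>])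
    fix s assume s: "exit_time x \<delta> \<omega> = ereal s"
    have "\<sigma> = min s T" using s by (simp add: \<sigma>_def stop_def min_def)
    then show ?thesis using s by (cases "s \<le> T") (auto simp: max_def zero_ereal_def)
  qed (simp add: \<sigma>_def stop_def)
  show ?thesis unfolding payoff_def 1 2 by (simp add: \<sigma>_def)
qed

text \<open>The truncation by \<open>max 0\<close> changes nothing on paths from \<open>0\<close>, and keeps \<open>rate\<close> bounded on the null set of the others;
  \<open>max 0 r\<close> avoids the negative times, at which nothing is known about \<open>x\<close>.\<close>

definition rate :: "real \<Rightarrow> real \<Rightarrow> real \<Rightarrow> real \<Rightarrow> 'a \<Rightarrow> real" where
  "rate \<delta> T \<alpha> r \<omega> = indicator {0<..<T} r * (2 * \<alpha> * (r - min r (stop \<delta> T \<omega>)) -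
      (if r < stop \<delta> T \<omega> then max 0 (\<delta>\<^sup>2 - (x (max 0 r) \<omega>)\<^sup>2) else 0))"

lemma measurable_stop_joint [measurable]:
  "0 < T \<Longrightarrow> (\<lambda>p. stop \<delta> T (snd p)) \<in> borel_measurable (lborel \<Otimes>\<^sub>M M)"
  by (rule measurable_compose[OF measurable_snd measurable_stop])

lemma measurable_payoff:
  assumes "0 < T" shows "payoff \<delta> T \<alpha> \<in> borel_measurable M"
proof -
  have m: "(\<lambda>p. indicator {0<..<T} (fst p) * (if fst p < stop \<delta> T (snd p) then (x (max 0 (fst p)) (snd p))\<^sup>2 else 0))
      \<in> borel_measurable (lborel \<Otimes>\<^sub>M M)"
    using assms by measurable
  from measurable_compose[OF measurable_pair_swap' m, unfolded case_prod_unfold fst_conv snd_conv]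
  have "(\<lambda>\<omega>. LINT r|lborel. indicator {0<..<T} r * (if r < stop \<delta> T \<omega> then (x (max 0 r) \<omega>)\<^sup>2 else 0)) \<in> borel_measurable M"
    by (intro lborel.borel_measurable_lebesgue_integral) (simp add: case_prod_unfold)
  moreover have "stop \<delta> T \<in> borel_measurable M" using assms by simp
  ultimately show ?thesis
    by (subst measurable_cong[OF payoff_eq[OF _ assms]]) auto
qed

text \<open>\<open>rate\<close> is bounded on the product of a bounded interval with a probability
  space and vanishes outside.\<close>

lemma integrable_rate:
  assumes "0 < T"
  shows "integrable (lborel \<Otimes>\<^sub>M M) (\<lambda>(r, \<omega>). rate \<delta> T \<alpha> r \<omega>)"
proof (rule integrableI_bounded_set)
  show "{0<..<T} \<times> space M \<in> sets (lborel \<Otimes>\<^sub>M M)" by simp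
  show "(\<lambda>(r, \<omega>). rate \<delta> T \<alpha> r \<omega>) \<in> borel_measurable (lborel \<Otimes>\<^sub>M M)"
    unfolding rate_def case_prod_beta' using assms by measurable
  show "emeasure (lborel \<Otimes>\<^sub>M M) ({0<..<T} \<times> space M) < \<infinity>"
    using assms by (subst emeasure_pair_measure_Times) (auto simp: emeasure_space_1)
  have "\<bar>rate \<delta> T \<alpha> r \<omega>\<bar> \<le> 2 * \<bar>\<alpha>\<bar> * T + \<delta>\<^sup>2" if "\<omega> \<in> space M" "r \<in> {0<..<T}" for r \<omega>
  proof -
    have s: "0 \<le> stop \<delta> T \<omega>" using stop_bounds[OF that(1), of T] assms by auto
    define A where "A = 2 * \<alpha> * (r - min r (stop \<delta> T \<omega>))"
    define B where "B = (if r < stop \<delta> T \<omega> then max 0 (\<delta>\<^sup>2 - (x (max 0 r) \<omega>)\<^sup>2) else 0)"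
    have "\<bar>A\<bar> \<le> 2 * \<bar>\<alpha>\<bar> * T"
      unfolding A_def abs_mult using s that by (intro mult_mono) auto
    moreover have "\<bar>B\<bar> \<le> \<delta>\<^sup>2" by (auto simp: B_def)
    moreover have "rate \<delta> T \<alpha> r \<omega> = A - B" using that(2) by (simp add: rate_def A_def B_def)
    ultimately show ?thesis by linarith
  qed
  then show "AE p in lborel \<Otimes>\<^sub>M M. p \<in> {0<..<T} \<times> space M \<longrightarrow> norm (case p of (r, \<omega>) \<Rightarrow> rate \<delta> T \<alpha> r \<omega>) \<le> 2 * \<bar>\<alpha>\<bar> * T + \<delta>\<^sup>2"
    by (intro AE_I2) auto
  show "AE p in lborel \<Otimes>\<^sub>M M. p \<notin> {0<..<T} \<times> space M \<longrightarrow> (case p of (r, \<omega>) \<Rightarrow> rate \<delta> T \<alpha> r \<omega>) = 0"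
    by (intro AE_I2) (auto simp: rate_def space_pair_measure indicator_eq_0_iff)
qed

lemma payoff_eq_rate:
  assumes "\<omega> \<in> space M" "x 0 \<omega> = 0" "0 < T" "0 < \<delta>"
  shows "payoff \<delta> T \<alpha> \<omega> = \<delta>\<^sup>2 * stop \<delta> T \<omega> + (LINT r|lborel. rate \<delta> T \<alpha> r \<omega>)"
proof -
  define \<sigma> where "\<sigma> = stop \<delta> T \<omega>"
  have \<sigma>: "0 \<le> \<sigma>" "\<sigma> \<le> T" using stop_bounds[OF assms(1), of T \<delta>] assms(3) by (auto simp: \<sigma>_def)
  define p where "p r = indicator {0<..<T} r * (if r < \<sigma> then max 0 (\<delta>\<^sup>2 - (x (max 0 r) \<omega>)\<^sup>2) else 0)" for r
  \<comment> \<open>Its integral is the square of \<open>T - \<sigma>\<close>, which turns the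
    terminal reward into a time integral.\<close>
  define q where "q r = indicator {\<sigma><..<T} r * (2 * (r - \<sigma>))" for r
  have "continuous_on UNIV (\<lambda>r. x (max 0 r) \<omega>)"
    by (rule continuous_on_compose2[OF continuous_paths[OF assms(1)]]) (auto intro!: continuous_intros)
  then have [measurable]: "(\<lambda>r. x (max 0 r) \<omega>) \<in> borel_measurable borel"
    by (rule borel_measurable_continuous_onI)
  have [measurable]: "p \<in> borel_measurable borel" unfolding p_def[abs_def] by measurable
  have ip: "integrable lborel p"
    by (rule integrableI_bounded_set[where A="{0<..<T}" and B="\<delta>\<^sup>2"]) (use assms in \<open>auto simp: p_def\<close>)
  have "has_bochner_integral lborel q ((T - \<sigma>)\<^sup>2 - (\<sigma> - \<sigma>)\<^sup>2)"
    unfolding q_def[abs_def]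
    by (rule has_bochner_integral_FTC_Ioo[where F="\<lambda>r. (r - \<sigma>)\<^sup>2"])
       (use \<sigma> in \<open>auto intro!: derivative_eq_intros continuous_intros\<close>)
  then have iq: "integrable lborel q" "integral\<^sup>L lborel q = (T - \<sigma>)\<^sup>2"
    by (auto simp: has_bochner_integral_iff)
  have "(LINT r|lborel. rate \<delta> T \<alpha> r \<omega>) = (LINT r|lborel. \<alpha> * q r - p r)"
    using \<sigma> by (intro Bochner_Integration.integral_cong) (auto simp: rate_def p_def q_def \<sigma>_def[symmetric] indicator_def min_def)
  also have "\<dots> = \<alpha> * (T - \<sigma>)\<^sup>2 - integral\<^sup>L lborel p" using ip iq by simp
  finally have r: "(LINT r|lborel. rate \<delta> T \<alpha> r \<omega>) = \<alpha> * (T - \<sigma>)\<^sup>2 - integral\<^sup>L lborel p" .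
  have "(LINT r|lborel. indicator {0<..<T} r * (if r < \<sigma> then (x (max 0 r) \<omega>)\<^sup>2 else 0)) =
      (LINT r|lborel. \<delta>\<^sup>2 * indicator {0<..<\<sigma>} r - p r)"
  proof (intro Bochner_Integration.integral_cong refl)
    fix r
    have "(x (max 0 r) \<omega>)\<^sup>2 \<le> \<delta>\<^sup>2" if "0 < r" "r < \<sigma>"
      using abs_le_before_stop[OF assms(1,2,4), of T r] that assms(3) power_mono[of "\<bar>x r \<omega>\<bar>" \<delta> 2]
      by (simp add: \<sigma>_def)
    then show "indicator {0<..<T} r * (if r < \<sigma> then (x (max 0 r) \<omega>)\<^sup>2 else 0) = \<delta>\<^sup>2 * indicator {0<..<\<sigma>} r - p r"
      using \<sigma> by (auto simp: p_def indicator_def max_def)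
  qed
  also have "\<dots> = \<delta>\<^sup>2 * \<sigma> - integral\<^sup>L lborel p"
    using ip \<sigma> by (subst Bochner_Integration.integral_diff) auto
  finally show ?thesis using r unfolding payoff_eq[OF assms(1,3)] \<sigma>_def[symmetric] by simp
qed

text \<open>Before \<open>T\<close>, the minimum of \<open>r\<close> and the stopping time for
  \<open>T\<close> is the stopping time for \<open>r\<close>, whose mean is known from
  \<open>expectation_stop\<close>; the rest of \<open>rate\<close> has mean
  -\<open>surv \<delta> r\<close>.\<close>

lemma expectation_rate:
  assumes "0 < r" "r < T" "0 < \<delta>"
  shows "expectation (rate \<delta> T \<alpha> r) = 2 * \<alpha> * (r - \<delta>\<^sup>2) + (2 * \<alpha> - 1) * surv \<delta> r"
proof -
  have T: "0 < T" using assms by simp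
  have [measurable]: "x r \<in> borel_measurable M" "stop \<delta> T \<in> borel_measurable M"
    "stop \<delta> r \<in> borel_measurable M" "avoids \<delta> r \<in> borel_measurable M" using assms T by auto
  have [measurable]: "rate \<delta> T \<alpha> r \<in> borel_measurable M"
    unfolding rate_def[abs_def] using assms by (simp add: max_absorb2)
  have stop_int: "integrable M (stop \<delta> r)"
    using stop_bounds assms(1) by (intro integrable_const_bound[of _ r] AE_I2) auto
  have "expectation (rate \<delta> T \<alpha> r) =
      expectation (\<lambda>\<omega>. 2 * \<alpha> * (r - stop \<delta> r \<omega>) - avoids \<delta> r \<omega> * (\<delta>\<^sup>2 - (x r \<omega>)\<^sup>2))"
  proof (rule integral_cong_AE)
    show "AE \<omega> in M. rate \<delta> T \<alpha> r \<omega> = 2 * \<alpha> * (r - stop \<delta> r \<omega>) - avoids \<delta> r \<omega> * (\<delta>\<^sup>2 - (x r \<omega>)\<^sup>2)"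
      using starts_at_zero AE_space
    proof eventually_elim
      case (elim \<omega>)
      have "(x r \<omega>)\<^sup>2 \<le> \<delta>\<^sup>2" if "r < stop \<delta> T \<omega>"
        using abs_le_before_stop[OF elim(2,1) assms(3), of T r] that T assms power_mono[of "\<bar>x r \<omega>\<bar>" \<delta> 2] by simp
      then show ?case
        using assms stop_min[OF elim(2), of r T \<delta>] avoids_eq_less_stop[OF elim(2), of r T \<delta>]
        by (auto simp: rate_def max_def)
    qed
  qed measurable
  also have "\<dots> = 2 * \<alpha> * (r - expectation (stop \<delta> r)) - surv \<delta> r"
    unfolding surv_def using stop_int integrable_avoids[OF assms(1,3)] by (simp add: prob_space)
  also have "\<dots> = 2 * \<alpha> * (r - \<delta>\<^sup>2) + (2 * \<alpha> - 1) * surv \<delta> r"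
    unfolding expectation_stop[OF assms(1,3)] by (simp add: algebra_simps)
  finally show ?thesis .
qed

text \<open>The pathwise form of the payoff is averaged, and Fubini's theorem replaces the mean of
  the time integral by the time integral of the known means of \<open>rate\<close>.\<close>

lemma Upsilon_eq_surv:
  assumes "0 < T" "0 < \<delta>"
  shows "Upsilon M x T \<alpha> \<delta> = \<delta>\<^sup>2 * (\<delta>\<^sup>2 - surv \<delta> T) + \<alpha> * (T\<^sup>2 - 2 * \<delta>\<^sup>2 * T)
    + (2 * \<alpha> - 1) * (LINT r|lborel. indicator {0<..<T} r * surv \<delta> r)"
proof -
  interpret P: pair_sigma_finite lborel M ..
  note ir = integrable_rate[OF assms(1), of \<delta> \<alpha>]
  have stop_int: "integrable M (stop \<delta> T)"
    using stop_bounds assms(1) by (intro integrable_const_bound[of _ T] AE_I2) auto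
  have i1: "integrable M (\<lambda>\<omega>. LINT r|lborel. rate \<delta> T \<alpha> r \<omega>)" using P.integrable_snd[OF ir] .
  have "Upsilon M x T \<alpha> \<delta> = expectation (payoff \<delta> T \<alpha>)"
    by (simp add: Upsilon_def payoff_def[abs_def])
  also have "\<dots> = expectation (\<lambda>\<omega>. \<delta>\<^sup>2 * stop \<delta> T \<omega> + (LINT r|lborel. rate \<delta> T \<alpha> r \<omega>))"
  proof (rule integral_cong_AE)
    show "AE \<omega> in M. payoff \<delta> T \<alpha> \<omega> = \<delta>\<^sup>2 * stop \<delta> T \<omega> + (LINT r|lborel. rate \<delta> T \<alpha> r \<omega>)"
      using starts_at_zero AE_space by eventually_elim (rule payoff_eq_rate[OF _ _ assms])
  qed (use measurable_payoff assms stop_int i1 in auto)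
  also have "\<dots> = \<delta>\<^sup>2 * expectation (stop \<delta> T) + expectation (\<lambda>\<omega>. LINT r|lborel. rate \<delta> T \<alpha> r \<omega>)"
    using stop_int i1 by simp
  also have "expectation (\<lambda>\<omega>. LINT r|lborel. rate \<delta> T \<alpha> r \<omega>) = (LINT r|lborel. expectation (rate \<delta> T \<alpha> r))"
    using P.Fubini_integral[OF ir] .
  also have "\<dots> = (LINT r|lborel. \<alpha> * (indicator {0<..<T} r * (2 * (r - \<delta>\<^sup>2))) + (2 * \<alpha> - 1) * (indicator {0<..<T} r * surv \<delta> r))"
  proof (intro Bochner_Integration.integral_cong refl)
    fix r :: real
    show "expectation (rate \<delta> T \<alpha> r) = \<alpha> * (indicator {0<..<T} r * (2 * (r - \<delta>\<^sup>2))) + (2 * \<alpha> - 1) * (indicator {0<..<T} r * surv \<delta> r)"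
    proof (cases "r \<in> {0<..<T}")
      case True
      then show ?thesis using expectation_rate[of r T \<delta> \<alpha>] assms by simp
    qed (simp add: rate_def[abs_def])
  qed
  also have "\<dots> = \<alpha> * (T\<^sup>2 - 2 * \<delta>\<^sup>2 * T) + (2 * \<alpha> - 1) * (LINT r|lborel. indicator {0<..<T} r * surv \<delta> r)"
  proof -
    have "has_bochner_integral lborel (\<lambda>r. indicator {0<..<T} r * (2 * (r - \<delta>\<^sup>2))) ((T\<^sup>2 - 2 * \<delta>\<^sup>2 * T) - (0\<^sup>2 - 2 * \<delta>\<^sup>2 * 0))"
      by (rule has_bochner_integral_FTC_Ioo[where F="\<lambda>r. r\<^sup>2 - 2 * \<delta>\<^sup>2 * r"])
         (use assms in \<open>auto intro!: derivative_eq_intros continuous_intros\<close>)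
    then show ?thesis using has_bochner_integral_surv[OF assms] by (simp add: has_bochner_integral_iff)
  qed
  finally show ?thesis by (simp add: expectation_stop[OF assms])
qed

end

section \<open>Passage from \<delta> to the dimensionless parameter \<open>lam\<close>\<close>

theorem mainTheorem3:
  fixes M :: "'a measure" and x :: "real \<Rightarrow> 'a \<Rightarrow> real" and T \<delta> \<alpha> lam :: real
  assumes "0 < T" and "0 < \<delta>" and "0 < \<alpha>"
    and "standard_brownian_motion M x"
    and "lam = T * pi\<^sup>2 / (8 * \<delta>\<^sup>2)"
  shows "Upsilon M x T \<alpha> \<delta> = T\<^sup>2 / 2 * (phi lam + (1 / 2 - \<alpha>) * psi lam)"
proof -
  interpret standard_brownian_motion M x by fact
  define S3 where "S3 = (\<Sum>k::nat. (- 1) ^ k * exp (- ((2 * real k + 1)\<^sup>2 * lam)) / (2 * real k + 1) ^ 3)"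
  define S5 where "S5 = (\<Sum>k::nat. (- 1) ^ k * exp (- ((2 * real k + 1)\<^sup>2 * lam)) / (2 * real k + 1) ^ 5)"
  have lam: "lam > 0" using assms by simp
  \<comment> \<open>Eliminating \<delta> leaves both sides as rational expressions in
    \<open>T\<close>, \<open>lam\<close>, \<open>pi\<close>, \<alpha> and the two series, so the
    last step is pure algebra.\<close>
  have d2: "\<delta>\<^sup>2 = T * pi\<^sup>2 / (8 * lam)" using assms lam by (simp add: field_simps)
  have d4: "\<delta> ^ 4 = (T * pi\<^sup>2 / (8 * lam))\<^sup>2" unfolding d2[symmetric] by simp
  have "surv \<delta> T = 32 * \<delta>\<^sup>2 / pi ^ 3 * S3"
  proof -
    have le: "exp (- ((2 * real k + 1)\<^sup>2 * lam)) \<le> 1" for k using lam by simp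
    have "summable (\<lambda>k. (- 1) ^ k * exp (- ((2 * real k + 1)\<^sup>2 * lam)) / (2 * real k + 1) ^ 3)"
      by (intro summable_comparison_test'[OF summable_inverse_odd_power[of 3], of 0])
         (use le in \<open>auto simp: abs_mult power_abs intro!: divide_right_mono\<close>)
    then have "(\<lambda>k. 32 * \<delta>\<^sup>2 / pi ^ 3 * ((- 1) ^ k * exp (- ((2 * real k + 1)\<^sup>2 * lam)) / (2 * real k + 1) ^ 3)) sums (32 * \<delta>\<^sup>2 / pi ^ 3 * S3)"
      unfolding S3_def by (intro sums_mult summable_sums)
    moreover have "32 * \<delta>\<^sup>2 / pi ^ 3 * ((- 1) ^ k * exp (- ((2 * real k + 1)\<^sup>2 * lam)) / (2 * real k + 1) ^ 3)
      = 32 * \<delta>\<^sup>2 / pi ^ 3 * ((-1) ^ k / (2 * real k + 1) ^ 3) * exp (- (((2 * real k + 1) * pi / (2 * \<delta>))\<^sup>2 * T / 2))" for k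
    proof -
      have "((2 * real k + 1) * pi / (2 * \<delta>))\<^sup>2 * T / 2 = (2 * real k + 1)\<^sup>2 * lam"
        using assms by (simp add: power_divide power_mult_distrib)
      then show ?thesis by simp
    qed
    ultimately show ?thesis by (intro sums_unique2[OF surv_sums[OF assms(1,2)]]) (simp only:)
  qed
  moreover have "(LINT r|lborel. indicator {0<..<T} r * surv \<delta> r) = 5 * \<delta> ^ 4 / 6 - 256 * \<delta> ^ 4 / pi ^ 5 * S5"
    using has_bochner_integral_surv[OF assms(1,2)] unfolding S5_def assms(5)
    by (simp add: has_bochner_integral_iff)
  ultimately have "Upsilon M x T \<alpha> \<delta> = \<delta>\<^sup>2 * (\<delta>\<^sup>2 - 32 * \<delta>\<^sup>2 / pi ^ 3 * S3) + \<alpha> * (T\<^sup>2 - 2 * \<delta>\<^sup>2 * T)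
    + (2 * \<alpha> - 1) * (5 * \<delta> ^ 4 / 6 - 256 * \<delta> ^ 4 / pi ^ 5 * S5)"
    using Upsilon_eq_surv[OF assms(1,2), of \<alpha>] by simp
  also have "\<dots> = T\<^sup>2 / 2 * (phi lam + (1 / 2 - \<alpha>) * psi lam)"
    unfolding phi_def psi_def S3_def[symmetric] S5_def[symmetric] d4 d2
    using lam by (simp add: field_simps eval_nat_numeral)
  finally show ?thesis .
qed

end
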